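(* Let $\beta\in\{1,2,4\}$ and let $p>m>n\ge 1$ be integers. Let $A\sim W^\beta_p(n,I_p)$ and $B\sim W^\beta_p(m,I_p)$ be independent, and let $U\sim W^\beta_m(n,I_m)$ and $W\sim W^\beta_m(p,I_m)$ be independent. Then the largest eigenvalue $q_1(AB^+)$ of $AB^+$ has the same distribution as the largest eigenvalue $q_1(UW^{-1})$ of $UW^{-1}$, where $B^+$ is the Moore–Penrose inverse of $B$.
   Context: $\mathbb{F}_1=\mathbb{R}$, $\mathbb{F}_2=\mathbb{C}$, $\mathbb{F}_4=\mathbb{H}$ (quaternions); $X^\ast$ is the conjugate transpose. For integers $m,n\ge1$ and an $m\times m$ positive definite Hermitian $\Sigma_0$ over $\mathbb{F}_\beta$, $X\sim N^\beta_{m,n}(O,\Sigma_0\otimes I_n)$ means that $X\in\mathbb{F}_\beta^{m\times n}$ has density $(2\pi\beta^{-1})^{-mn\beta/2}|\Sigma_0|^{-n\beta/2}\exp\{-\tfrac{\beta}{2}\mathrm{tr}(X^\ast\Sigma_0^{-1}X)\}$ with respect to Lebesgue measure ($|\Sigma_0|$ being the product of the eigenvalues of $\Sigma_0$), and $W^\beta_m(n,\Sigma_0)$ is the law of the $m\times m$ matrix $XX^\ast$. It is called nonsingular if $n\ge m$ and singular (rank $n$) if $n<m$; in particular $A$, $B$ and $U$ above are singular, and $W$ is nonsingular. *)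

theory Defs
  imports "HOL-Probability.Probability"
begin

section \<open>Quaternions\<close>

codatatype quat = Quat (qRe: real) (qI: real) (qJ: real) (qK: real)

lemma quat_eq_iff: "x = y \<longleftrightarrow> qRe x = qRe y \<and> qI x = qI y \<and> qJ x = qJ y \<and> qK x = qK y"
  by (cases x; cases y) simp

instantiation quat :: ab_group_add
begin

primcorec zero_quat where
  "qRe 0 = 0" | "qI 0 = 0" | "qJ 0 = 0" | "qK 0 = 0"

primcorec plus_quat where
  "qRe (x + y) = qRe x + qRe y"
| "qI (x + y) = qI x + qI y"
| "qJ (x + y) = qJ x + qJ y"
| "qK (x + y) = qK x + qK y"

primcorec uminus_quat where
  "qRe (- x) = - qRe x" | "qI (- x) = - qI x" | "qJ (- x) = - qJ x" | "qK (- x) = - qK x"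

primcorec minus_quat where
  "qRe (x - y) = qRe x - qRe y"
| "qI (x - y) = qI x - qI y"
| "qJ (x - y) = qJ x - qJ y"
| "qK (x - y) = qK x - qK y"

instance
  by standard (simp_all add: quat_eq_iff)

end

definition quat_norm2 :: "quat \<Rightarrow> real" where
  "quat_norm2 x = (qRe x)\<^sup>2 + (qI x)\<^sup>2 + (qJ x)\<^sup>2 + (qK x)\<^sup>2"

lemma quat_norm2_eq_0: "quat_norm2 x = 0 \<longleftrightarrow> x = 0"
proof
  assume "quat_norm2 x = 0"
  then show "x = 0"
    by (simp add: quat_norm2_def quat_eq_iff add_nonneg_eq_0_iff)
qed (simp add: quat_norm2_def)

instantiation quat :: division_ring
begin

primcorec one_quat where
  "qRe 1 = 1" | "qI 1 = 0" | "qJ 1 = 0" | "qK 1 = 0"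

primcorec times_quat where
  "qRe (x * y) = qRe x * qRe y - qI x * qI y - qJ x * qJ y - qK x * qK y"
| "qI (x * y) = qRe x * qI y + qI x * qRe y + qJ x * qK y - qK x * qJ y"
| "qJ (x * y) = qRe x * qJ y - qI x * qK y + qJ x * qRe y + qK x * qI y"
| "qK (x * y) = qRe x * qK y + qI x * qJ y - qJ x * qI y + qK x * qRe y"

primcorec inverse_quat where
  "qRe (inverse x) = qRe x / quat_norm2 x"
| "qI (inverse x) = - qI x / quat_norm2 x"
| "qJ (inverse x) = - qJ x / quat_norm2 x"
| "qK (inverse x) = - qK x / quat_norm2 x"

definition "x div y = x * inverse y" for x y :: quat

instance
proof
  fix x y z :: quat
  show "x * y * z = x * (y * z)" "(x + y) * z = x * z + y * z" "x * (y + z) = x * y + x * z"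
    by (simp_all add: quat_eq_iff algebra_simps)
  show "1 * x = x" "x * 1 = x" "(0::quat) \<noteq> 1"
    by (simp_all add: quat_eq_iff)
  show "x div y = x * inverse y" by (rule divide_quat_def)
  show "inverse (0::quat) = 0" by (simp add: quat_eq_iff)
  assume "x \<noteq> 0"
  then have "quat_norm2 x \<noteq> 0" by (simp add: quat_norm2_eq_0)
  moreover have "qRe x / quat_norm2 x * qRe x + qI x / quat_norm2 x * qI x
      + qJ x / quat_norm2 x * qJ x + qK x / quat_norm2 x * qK x = quat_norm2 x / quat_norm2 x"
    by (simp only: quat_norm2_def power2_eq_square add_divide_distrib times_divide_eq_left)
  ultimately show "inverse x * x = 1" "x * inverse x = 1"
    by (simp_all add: quat_eq_iff mult.commute)
qed

end

instantiation quat :: real_algebra_1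
begin

primcorec scaleR_quat where
  "qRe (scaleR r x) = r * qRe x"
| "qI (scaleR r x) = r * qI x"
| "qJ (scaleR r x) = r * qJ x"
| "qK (scaleR r x) = r * qK x"

instance
  by standard (simp_all add: quat_eq_iff algebra_simps)

end

instance quat :: real_div_algebra ..

instantiation quat :: real_inner
begin

definition inner_quat_def:
  "inner x y = qRe x * qRe y + qI x * qI y + qJ x * qJ y + qK x * qK y"

definition norm_quat_def: "norm x = sqrt (quat_norm2 x)"

definition sgn_quat_def: "sgn x = x /\<^sub>R norm x" for x :: quat

definition dist_quat_def: "dist x y = norm (x - y)" for x y :: quat

definition uniformity_quat_def [code del]:
  "(uniformity :: (quat \<times> quat) filter) = (INF e\<in>{0 <..}. principal {(x, y). dist x y < e})"

definition open_quat_def [code del]: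
  "open (U :: quat set) \<longleftrightarrow> (\<forall>x\<in>U. eventually (\<lambda>(x', y). x' = x \<longrightarrow> y \<in> U) uniformity)"

instance
proof
  fix x y z :: quat and r :: real and U :: "quat set"
  show "sgn x = x /\<^sub>R norm x" by (rule sgn_quat_def)
  show "dist x y = norm (x - y)" by (rule dist_quat_def)
  show "(uniformity :: (quat \<times> quat) filter) = (INF e\<in>{0 <..}. principal {(x, y). dist x y < e})"
    by (rule uniformity_quat_def)
  show "open U \<longleftrightarrow> (\<forall>x\<in>U. eventually (\<lambda>(x', y). x' = x \<longrightarrow> y \<in> U) uniformity)"
    by (rule open_quat_def)
  show "inner x y = inner y x" "inner (x + y) z = inner x z + inner y z"
    "inner (scaleR r x) y = r * inner x y"
    by (simp_all add: inner_quat_def algebra_simps)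
  have eq: "inner x x = quat_norm2 x"
    by (simp add: inner_quat_def quat_norm2_def power2_eq_square)
  show "0 \<le> inner x x" by (simp add: eq quat_norm2_def)
  show "inner x x = 0 \<longleftrightarrow> x = 0" by (simp add: eq quat_norm2_eq_0)
  show "norm x = sqrt (inner x x)" by (simp add: eq norm_quat_def)
qed

end

instance quat :: real_normed_div_algebra
proof
  fix x y :: quat
  have "quat_norm2 (x * y) = quat_norm2 x * quat_norm2 y"
    by (simp add: quat_norm2_def power2_eq_square algebra_simps)
  then show "norm (x * y) = norm x * norm y"
    by (simp add: norm_quat_def real_sqrt_mult)
qed

instantiation quat :: euclidean_space
begin

definition Basis_quat_def:
  "Basis = {1, Quat 0 1 0 0, Quat 0 0 1 0, Quat 0 0 0 1}"

instance
proof
  show "(Basis :: quat set) \<noteq> {}" "finite (Basis :: quat set)"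
    by (simp_all add: Basis_quat_def)
  fix u v x :: quat
  show "(\<forall>u\<in>Basis. inner x u = 0) \<longleftrightarrow> x = 0"
    by (simp add: Basis_quat_def inner_quat_def quat_eq_iff [of x 0])
  assume "u \<in> Basis" "v \<in> Basis"
  then show "inner u v = (if u = v then 1 else 0)"
    unfolding Basis_quat_def
    by (elim insertE emptyE; hypsubst; simp add: inner_quat_def quat_eq_iff)
qed

end

lemma DIM_quat [simp]: "DIM(quat) = 4"
  by (simp add: Basis_quat_def quat_eq_iff)


section \<open>Scalars with conjugation\<close>

class hermitian_scalar = real_normed_div_algebra + euclidean_space +
  fixes hconj :: "'a \<Rightarrow> 'a"
  assumes hconj_add: "hconj (x + y) = hconj x + hconj y"
    and hconj_scaleR: "hconj (r *\<^sub>R x) = r *\<^sub>R hconj x"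
    and hconj_hconj: "hconj (hconj x) = x"
    and hconj_mult: "hconj (x * y) = hconj y * hconj x"
    and mult_hconj: "x * hconj x = (norm x)\<^sup>2 *\<^sub>R 1"

instantiation real :: hermitian_scalar
begin

definition hconj_real_def: "hconj x = x" for x :: real

instance
  by standard (simp_all add: hconj_real_def power2_eq_square)

end

instantiation complex :: hermitian_scalar
begin

definition hconj_complex_def: "hconj x = cnj x"

instance
proof
  fix x y :: complex and r :: real
  show "hconj (x + y) = hconj x + hconj y" "hconj (r *\<^sub>R x) = r *\<^sub>R hconj x"
    "hconj (hconj x) = x" "hconj (x * y) = hconj y * hconj x"
    by (simp_all add: hconj_complex_def)
  show "x * hconj x = (norm x)\<^sup>2 *\<^sub>R 1"
    unfolding hconj_complex_def scaleR_conv_of_real complex_norm_square by simp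
qed

end

instantiation quat :: hermitian_scalar
begin

definition hconj_quat_def: "hconj x = Quat (qRe x) (- qI x) (- qJ x) (- qK x)"

instance
proof
  fix x y :: quat and r :: real
  show "hconj (x + y) = hconj x + hconj y" "hconj (r *\<^sub>R x) = r *\<^sub>R hconj x"
    "hconj (hconj x) = x" "hconj (x * y) = hconj y * hconj x"
    by (simp_all add: hconj_quat_def quat_eq_iff algebra_simps)
  have "(norm x)\<^sup>2 = quat_norm2 x"
    by (simp add: norm_quat_def quat_norm2_def)
  then show "x * hconj x = (norm x)\<^sup>2 *\<^sub>R 1"
    by (simp add: hconj_quat_def quat_eq_iff quat_norm2_def power2_eq_square)
qed

end

text \<open>For every scalar type above, \<^term>\<open>1\<close> is a unit basis vector, so this is the usual real part.\<close>

definition real_part :: "'a::hermitian_scalar \<Rightarrow> real" where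
  "real_part x = inner x 1"

lemma real_part_real: "real_part (x::real) = x"
  and real_part_complex: "real_part z = Re z"
  and real_part_quat: "real_part q = qRe q"
  by (simp_all add: real_part_def inner_quat_def)


section \<open>Matrices\<close>

definition ctranspose :: "'a::hermitian_scalar^'n^'m \<Rightarrow> 'a^'m^'n" where
  "ctranspose X = (\<chi> i j. hconj (X $ j $ i))"

text \<open>Scalars multiply vectors from the right, which commutes with applying a matrix; over the
  quaternions this gives the right eigenvalues.\<close>

definition right_eigenvalue :: "'a::hermitian_scalar^'m^'m \<Rightarrow> 'a \<Rightarrow> bool" where
  "right_eigenvalue M c \<longleftrightarrow> (\<exists>x. x \<noteq> 0 \<and> M *v x = (\<chi> i. x $ i * c))"

text \<open>Meant for matrices all of whose eigenvalues are real, such as Hermitian matrices and products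
  of two positive semidefinite matrices. The value is unspecified if there is no real eigenvalue.\<close>

definition largest_eigenvalue :: "'a::hermitian_scalar^'m^'m \<Rightarrow> real" where
  "largest_eigenvalue M = (GREATEST r. right_eigenvalue M (of_real r))"

text \<open>Product of the eigenvalues of a Hermitian matrix, counted with multiplicity. As \<^term>\<open>dim\<close>
  is the real dimension, it is divided by that of the scalars.\<close>

definition eigenvalue_prod :: "'a::hermitian_scalar^'m^'m \<Rightarrow> real" where
  "eigenvalue_prod S = (\<Prod>r | right_eigenvalue S (of_real r).
     r ^ (dim {x. S *v x = r *\<^sub>R x} div DIM('a)))"

definition is_moore_penrose :: "'a::hermitian_scalar^'n^'m \<Rightarrow> 'a^'m^'n \<Rightarrow> bool" where
  "is_moore_penrose A G \<longleftrightarrow>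
     A ** G ** A = A \<and> G ** A ** G = G \<and>
     ctranspose (A ** G) = A ** G \<and> ctranspose (G ** A) = G ** A"

definition moore_penrose_inv :: "'a::hermitian_scalar^'n^'m \<Rightarrow> 'a^'m^'n" where
  "moore_penrose_inv A = (THE G. is_moore_penrose A G)"


section \<open>Matrix normal and Wishart distributions\<close>

text \<open>The parameter \<open>\<beta>\<close> is \<^term>\<open>DIM('a::hermitian_scalar)\<close>, and \<open>S\<close> is meant to be positive definite Hermitian.\<close>

definition matrix_normal_density ::
    "'a::hermitian_scalar^'m^'m \<Rightarrow> 'a^'n^'m \<Rightarrow> real" where
  "matrix_normal_density S X =
     (2 * pi / real DIM('a)) powr (- (real CARD('m) * real CARD('n) * real DIM('a) / 2))
     * eigenvalue_prod S powr (- (real CARD('n) * real DIM('a) / 2))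
     * exp (- (real DIM('a) / 2) * real_part (trace (ctranspose X ** matrix_inv S ** X)))"

definition matrix_normal :: "'a::hermitian_scalar^'m^'m \<Rightarrow> ('a^'n^'m) measure" where
  "matrix_normal S = density lborel (\<lambda>X. ennreal (matrix_normal_density S X))"

text \<open>The number of degrees of freedom is the cardinality of the index type passed as first argument.\<close>

definition wishart ::
    "'n::finite itself \<Rightarrow> 'a::hermitian_scalar^'m^'m \<Rightarrow> ('a^'m^'m) measure" where
  "wishart _ S = distr (matrix_normal S :: ('a^'n^'m) measure) borel (\<lambda>X. X ** ctranspose X)"

definition same_distribution ::
    "'s measure \<Rightarrow> ('s \<Rightarrow> real) \<Rightarrow> 't measure \<Rightarrow> ('t \<Rightarrow> real) \<Rightarrow> bool" where
  "same_distribution M X N Y \<longleftrightarrow>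
     X \<in> borel_measurable M \<and> Y \<in> borel_measurable N \<and> distr M borel X = distr N borel Y"

end

theory Submission
  imports Defs
begin

text \<open>
  Write \<open>A = X X*\<close> and \<open>B = Y Y*\<close> with independent standard Gaussian matrices \<open>X\<close> (of size
  \<open>p \<times> n\<close>) and \<open>Y\<close> (of size \<open>p \<times> m\<close>), and condition on \<open>Y\<close>, which is injective
  almost surely (\<open>null_sets_lborel_not_injective\<close>). Let \<open>S\<close> be a Hermitian square root of
  \<open>Y* Y\<close> and \<open>H = Y S^-1\<close>, as in the polar decomposition of \<open>Y\<close>. Then
  \<open>H* H = 1\<close> and \<open>B^+ = H (Y* Y)^-1 H*\<close>, hence with \<open>P = X X* H (Y* Y)^-1\<close> and
  \<open>Z = H* X\<close> one has \<open>A B^+ = P H*\<close> and \<open>Z Z* (Y* Y)^-1 = H* P\<close>. The two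
  products have the same nonzero eigenvalues. Since \<open>n < m < p\<close>, both are singular, so \<open>0\<close>
  is an eigenvalue of both as well, and their largest eigenvalues agree
  (\<open>largest_eigenvalue_reduction\<close>).

  It remains to see what is random. For fixed \<open>Y\<close> the map \<open>X \<mapsto> H* X\<close> is real linear and its
  adjoint \<open>Z \<mapsto> H Z\<close> is a right inverse, so it carries the standard Gaussian measure to the
  standard Gaussian measure (\<open>distr_gaussian_coisometry\<close>): given \<open>Y\<close>, the matrix \<open>Z Z*\<close> is
  distributed as \<open>U\<close>. Taking adjoints of Gaussian matrices shows that \<open>Y* Y\<close> is distributed
  as \<open>W\<close>. Integrating over \<open>Y\<close> gives the claim. The matrix \<open>H\<close> serves to identify one
  conditional law at a time and does not occur in the integral, so it may be chosen arbitrarily for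
  each \<open>Y\<close>.

  Everything is done over an arbitrary scalar algebra with conjugation, treated as a real inner
  product space: matrices are real linear maps, and the conjugate transpose is the real adjoint. This
  treats the three cases, commutative or not, at once. The square root comes from Brouwer's fixed
  point theorem (\<open>gram_square_root\<close>).

  The random matrices are only known in distribution, so the measurability part of the claim
  concerns all matrices, including those that have no inverse or no real eigenvalue. Each of the
  functions involved has a closed graph up to a constant default value or is a maximum over a closed
  relation, and projections of closed sets along a Euclidean factor are Borel sets
  (\<open>borel_projection_of_closed\<close>).
\<close>

section \<open>Hermitian scalars and conjugate transposes\<close>

lemma hconj_zero [simp]: "hconj (0::'a::hermitian_scalar) = 0"
  using hconj_scaleR[of 0 "0::'a"] by simp

lemma hconj_one [simp]: "hconj (1::'a::hermitian_scalar) = 1"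
  using mult_hconj[of "1::'a"] by simp

lemma hconj_sum: "hconj (sum f A) = (\<Sum>x\<in>A. hconj (f x :: 'a::hermitian_scalar))"
  by (induction A rule: infinite_finite_induct) (simp_all add: hconj_add)

text \<open>
  This is \<open>x x* = |x|^2\<close> polarized. It expresses conjugation and the real inner
  product through each other.
\<close>

lemma hconj_polarization:
  "x * hconj y + y * hconj x = (2 * inner x y) *\<^sub>R (1::'a::hermitian_scalar)"
proof -
  have "(x + y) * hconj (x + y) = (norm (x + y))\<^sup>2 *\<^sub>R 1"
    by (rule mult_hconj)
  also have "(norm (x + y))\<^sup>2 = (norm x)\<^sup>2 + (norm y)\<^sup>2 + 2 * inner x y"
    by (simp add: power2_norm_eq_inner inner_add inner_commute)
  finally show ?thesis
    by (simp add: hconj_add algebra_simps mult_hconj)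
qed

lemma hconj_eq_reflection: "hconj x = (2 * inner x 1) *\<^sub>R 1 - (x::'a::hermitian_scalar)"
  using hconj_polarization[of x 1] by (simp add: algebra_simps)

lemma inner_one_hconj: "inner (hconj x) 1 = inner x (1::'a::hermitian_scalar)"
  by (simp add: hconj_eq_reflection inner_diff_left dot_square_norm)

lemma inner_eq_mult_hconj: "inner x y = inner (x * hconj y) (1::'a::hermitian_scalar)"
proof -
  have "inner (y * hconj x) 1 = inner (x * hconj y) 1"
    using inner_one_hconj[of "x * hconj y"] by (simp add: hconj_mult hconj_hconj)
  moreover have "inner (x * hconj y + y * hconj x) 1 = 2 * inner x y"
    by (simp only: hconj_polarization) (simp add: dot_square_norm)
  ultimately show ?thesis
    by (simp add: inner_add_left)
qed

lemma inner_hconj: "inner (hconj x) (hconj y) = inner x (y::'a::hermitian_scalar)"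
  by (simp add: hconj_eq_reflection inner_diff_left inner_diff_right dot_square_norm
      inner_commute[of 1] algebra_simps)

lemma inner_hconj_commute: "inner (hconj x) y = inner x (hconj (y::'a::hermitian_scalar))"
  using inner_hconj[of x "hconj y"] by (simp add: hconj_hconj)

text \<open>
  The real part is a trace, in spite of noncommutativity: \<open>x y\<close> has the real part
  \<open>\<langle>x, y*\<rangle>\<close>, and conjugation is an isometry.
\<close>

lemma inner_one_mult_commute: "inner (x * y) 1 = inner (y * x) (1::'a::hermitian_scalar)"
proof -
  have "inner (x * y) 1 = inner x (hconj y)"
    by (simp add: inner_eq_mult_hconj[of x "hconj y"] hconj_hconj)
  also have "\<dots> = inner (hconj x) y"
    by (simp add: inner_hconj_commute)
  also have "\<dots> = inner (y * x) 1"
    by (simp add: inner_commute[of "hconj x"] inner_eq_mult_hconj[of y "hconj x"] hconj_hconj)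
  finally show ?thesis .
qed

text \<open>
  Conjugation is the adjoint for the real inner product; the matrix versions below follow
  entrywise. They let \<^const>\<open>ctranspose\<close> be used as the adjoint of a real linear
  map.
\<close>

lemma inner_mult_left_adjoint: "inner (a * x) y = inner x (hconj a * (y::'a::hermitian_scalar))"
proof -
  have "inner (a * x) y = inner (a * (x * hconj y)) 1"
    by (simp add: inner_eq_mult_hconj[of "a * x"] mult.assoc)
  also have "\<dots> = inner ((x * hconj y) * a) 1"
    by (rule inner_one_mult_commute)
  also have "\<dots> = inner x (hconj a * y)"
    by (simp add: inner_eq_mult_hconj[of x "hconj a * y"] hconj_mult hconj_hconj mult.assoc)
  finally show ?thesis .
qed

lemma ctranspose_nth [simp]: "ctranspose X $ i $ j = hconj (X $ j $ i)"
  by (simp add: ctranspose_def)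

lemma ctranspose_ctranspose [simp]: "ctranspose (ctranspose X) = X"
  by (simp add: vec_eq_iff hconj_hconj)

lemma ctranspose_matrix_mult: "ctranspose (X ** Y) = ctranspose Y ** ctranspose X"
  by (simp add: vec_eq_iff matrix_matrix_mult_def hconj_sum hconj_mult)

lemma ctranspose_mat_one [simp]: "ctranspose (mat 1) = mat 1"
  by (simp add: vec_eq_iff mat_def)

lemma ctranspose_add: "ctranspose (X + Y) = ctranspose X + ctranspose Y"
  by (simp add: vec_eq_iff hconj_add)

lemma ctranspose_scaleR: "ctranspose (r *\<^sub>R X) = r *\<^sub>R ctranspose X"
  by (simp add: vec_eq_iff hconj_scaleR)

lemma linear_ctranspose: "linear ctranspose"
  by (rule linearI) (simp_all add: ctranspose_add ctranspose_scaleR)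

lemma inner_ctranspose: "inner (ctranspose X) Y = inner X (ctranspose Y)"
proof -
  have "inner (ctranspose X) Y = (\<Sum>j\<in>UNIV. \<Sum>i\<in>UNIV. inner (hconj (X $ i $ j)) (Y $ j $ i))"
    by (simp add: inner_vec_def)
  also have "\<dots> = (\<Sum>j\<in>UNIV. \<Sum>i\<in>UNIV. inner (X $ i $ j) (hconj (Y $ j $ i)))"
    by (simp add: inner_hconj_commute)
  also have "\<dots> = inner X (ctranspose Y)"
    by (subst sum.swap) (simp add: inner_vec_def)
  finally show ?thesis .
qed

lemma inner_matrix_mult_left:
  fixes M :: "'a::hermitian_scalar^'n^'m"
  shows "inner (M ** X) Y = inner X (ctranspose M ** Y)"
proof -
  have "inner (M ** X) Y =
      (\<Sum>i\<in>UNIV. \<Sum>j\<in>UNIV. \<Sum>k\<in>UNIV. inner (M $ i $ k * X $ k $ j) (Y $ i $ j))"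
    by (simp add: inner_vec_def matrix_matrix_mult_def inner_sum_left)
  also have "\<dots> = (\<Sum>i\<in>UNIV. \<Sum>j\<in>UNIV. \<Sum>k\<in>UNIV. inner (X $ k $ j) (hconj (M $ i $ k) * Y $ i $ j))"
    by (simp add: inner_mult_left_adjoint)
  also have "\<dots> = (\<Sum>i\<in>UNIV. \<Sum>k\<in>UNIV. \<Sum>j\<in>UNIV. inner (X $ k $ j) (hconj (M $ i $ k) * Y $ i $ j))"
    by (rule sum.cong[OF refl], rule sum.swap)
  also have "\<dots> = (\<Sum>k\<in>UNIV. \<Sum>i\<in>UNIV. \<Sum>j\<in>UNIV. inner (X $ k $ j) (hconj (M $ i $ k) * Y $ i $ j))"
    by (rule sum.swap)
  also have "\<dots> = (\<Sum>k\<in>UNIV. \<Sum>j\<in>UNIV. \<Sum>i\<in>UNIV. inner (X $ k $ j) (hconj (M $ i $ k) * Y $ i $ j))"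
    by (rule sum.cong[OF refl], rule sum.swap)
  also have "\<dots> = inner X (ctranspose M ** Y)"
    by (simp add: inner_vec_def matrix_matrix_mult_def inner_sum_right)
  finally show ?thesis .
qed

lemma inner_matrix_vector_mult_left:
  fixes M :: "'a::hermitian_scalar^'n^'m"
  shows "inner (M *v x) y = inner x (ctranspose M *v y)"
proof -
  have "inner (M *v x) y = (\<Sum>i\<in>UNIV. \<Sum>k\<in>UNIV. inner (M $ i $ k * x $ k) (y $ i))"
    by (simp add: inner_vec_def matrix_vector_mult_def inner_sum_left)
  also have "\<dots> = (\<Sum>k\<in>UNIV. \<Sum>i\<in>UNIV. inner (x $ k) (hconj (M $ i $ k) * y $ i))"
    by (subst sum.swap) (simp add: inner_mult_left_adjoint)
  also have "\<dots> = inner x (ctranspose M *v y)"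
    by (simp add: inner_vec_def matrix_vector_mult_def inner_sum_right)
  finally show ?thesis .
qed

lemma real_part_trace_gram:
  fixes X :: "'a::hermitian_scalar^'n^'m"
  shows "real_part (trace (ctranspose X ** X)) = (norm X)\<^sup>2"
proof -
  have "real_part (trace (ctranspose X ** X)) =
      (\<Sum>j\<in>UNIV. \<Sum>i\<in>UNIV. inner (hconj (X $ i $ j) * X $ i $ j) 1)"
    by (simp add: real_part_def trace_def matrix_matrix_mult_def inner_sum_left)
  also have "\<dots> = (\<Sum>j\<in>UNIV. \<Sum>i\<in>UNIV. inner (X $ i $ j) (X $ i $ j))"
    by (simp add: inner_mult_left_adjoint hconj_hconj)
  also have "\<dots> = inner X X"
    by (subst sum.swap) (simp add: inner_vec_def)
  finally show ?thesis
    by (simp add: power2_norm_eq_inner)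
qed

lemma scaleR_matrix_mult: "(r *\<^sub>R A) ** B = r *\<^sub>R (A ** (B :: 'a::real_algebra_1^'p^'n))"
  by (rule scalar_matrix_assoc[symmetric])

lemma matrix_diff_ldistrib: "A ** (B - C) = A ** B - A ** (C :: 'a::ring_1^'p^'n)"
  by (simp add: vec_eq_iff matrix_matrix_mult_def right_diff_distrib sum_subtractf)

lemma matrix_diff_rdistrib: "(A - B) ** C = A ** C - B ** (C :: 'a::ring_1^'p^'n)"
  by (simp add: vec_eq_iff matrix_matrix_mult_def left_diff_distrib sum_subtractf)

lemma scaleR_matrix_vector: "(r *\<^sub>R A) *v x = r *\<^sub>R (A *v (x :: 'a::real_algebra_1^'n))"
  by (simp add: vec_eq_iff matrix_vector_mult_def scaleR_sum_right)

lemma matrix_vector_scaleR: "A *v (r *\<^sub>R x) = r *\<^sub>R (A *v (x :: 'a::real_algebra_1^'n))"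
  by (simp add: vec_eq_iff matrix_vector_mult_def scaleR_sum_right)

lemma continuous_on_matrix_mult [continuous_intros]:
  fixes f :: "'b::topological_space \<Rightarrow> 'a::real_normed_algebra_1^'n^'m"
  assumes "continuous_on S f" "continuous_on S g"
  shows "continuous_on S (\<lambda>x. f x ** g x)"
  unfolding matrix_matrix_mult_def by (intro continuous_intros assms)

lemma continuous_on_matrix_vector_mult [continuous_intros]:
  fixes f :: "'b::topological_space \<Rightarrow> 'a::real_normed_algebra_1^'n^'m"
  assumes "continuous_on S f" "continuous_on S g"
  shows "continuous_on S (\<lambda>x. f x *v g x)"
  unfolding matrix_vector_mult_def by (intro continuous_intros assms)

lemma continuous_on_ctranspose [continuous_intros]:
  fixes f :: "'b::topological_space \<Rightarrow> 'a::hermitian_scalar^'n^'m"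
  assumes "continuous_on S f"
  shows "continuous_on S (\<lambda>x. ctranspose (f x))"
  using continuous_on_compose2[OF linear_continuous_on[OF linear_linear[THEN iffD2, OF linear_ctranspose], of UNIV] assms]
  by simp

section \<open>Square roots of Gram matrices\<close>

lemma matrix_axis_nth: "(M *v axis j 1) $ i = (M $ i $ j :: 'a::semiring_1)"
  by (simp add: matrix_vector_mult_def axis_def if_distrib cong: if_cong)

lemma norm_axis_one: "norm (axis j (1::'a::{real_normed_algebra_1, real_inner}) :: 'a^'n) = 1"
  by (simp add: norm_eq_1[of "axis j 1"] inner_axis_axis norm_eq_1[of "1::'a", symmetric])

text \<open>
  Solving \<open>2 N = M + N^2\<close> amounts to finding a square root \<open>1 - N\<close> of
  \<open>1 - M\<close>. The map \<open>N \<mapsto> (M + N^2) / 2\<close> sends the compact convex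
  set of Hermitian contractions to itself, so it has a fixed point by Brouwer's theorem.
\<close>

lemma hermitian_fixed_point:
  fixes M :: "'a::hermitian_scalar^'m^'m"
  assumes herm: "ctranspose M = M" and contr: "\<And>x. norm (M *v x) \<le> norm x"
  obtains N where "ctranspose N = N" "2 *\<^sub>R N = M + N ** N"
proof -
  define K where "K = {N :: 'a^'m^'m. ctranspose N = N \<and> (\<forall>x. norm (N *v x) \<le> norm x)}"
  define f where "f N = (1/2) *\<^sub>R (M + N ** N)" for N
  have "closed K"
    unfolding K_def Collect_conj_eq Collect_all_eq
    by (intro closed_Int closed_INT ballI closed_Collect_eq closed_Collect_le continuous_intros)
  moreover have "bounded K"
  proof (rule boundedI)
    fix N assume "N \<in> K"
    have "norm (N $ i $ j) \<le> 1" for i j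
    proof -
      have "norm (N $ i $ j) \<le> norm (N *v axis j 1)"
        using Finite_Cartesian_Product.norm_nth_le[of "N *v axis j 1" i] by (simp add: matrix_axis_nth)
      also have "\<dots> \<le> norm (axis j 1 :: 'a^'m)"
        using \<open>N \<in> K\<close> unfolding K_def by blast
      also have "\<dots> = 1"
        by (rule norm_axis_one)
      finally show ?thesis .
    qed
    then have "norm (N $ i) \<le> (\<Sum>j\<in>(UNIV::'m set). 1)" for i
      unfolding norm_vec_def by (intro order.trans[OF L2_set_le_sum] sum_mono) auto
    then show "norm N \<le> (\<Sum>i\<in>(UNIV::'m set). \<Sum>j\<in>(UNIV::'m set). 1)"
      unfolding norm_vec_def[of N] by (intro order.trans[OF L2_set_le_sum] sum_mono) auto
  qed
  ultimately have "compact K"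
    by (simp add: compact_eq_bounded_closed)
  moreover have "convex K"
  proof (rule convexI)
    fix A B :: "'a^'m^'m" and u v :: real
    assume *: "A \<in> K" "B \<in> K" "0 \<le> u" "0 \<le> v" "u + v = 1"
    have "norm ((u *\<^sub>R A + v *\<^sub>R B) *v x) \<le> norm x" for x
    proof -
      have "norm ((u *\<^sub>R A + v *\<^sub>R B) *v x) \<le> u * norm (A *v x) + v * norm (B *v x)"
        using * norm_triangle_ineq[of "u *\<^sub>R (A *v x)" "v *\<^sub>R (B *v x)"]
        by (simp add: matrix_vector_mult_add_rdistrib scaleR_matrix_vector)
      also have "\<dots> \<le> u * norm x + v * norm x"
        using * by (intro add_mono mult_left_mono) (auto simp: K_def)
      also have "\<dots> = norm x"
        using * by (simp flip: distrib_right)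
      finally show ?thesis .
    qed
    then show "u *\<^sub>R A + v *\<^sub>R B \<in> K"
      using * by (simp add: K_def ctranspose_add ctranspose_scaleR)
  qed
  moreover have "0 \<in> K"
    by (simp add: K_def vec_eq_iff)
  moreover have "continuous_on K f"
    unfolding f_def by (intro continuous_intros)
  moreover have "f \<in> K \<rightarrow> K"
  proof
    fix N assume N: "N \<in> K"
    have "norm (f N *v x) \<le> norm x" for x
    proof -
      have "norm (f N *v x) \<le> (norm (M *v x) + norm (N *v (N *v x))) / 2"
        using norm_triangle_ineq[of "M *v x" "(N ** N) *v x"]
        by (simp add: f_def scaleR_matrix_vector matrix_vector_mult_add_rdistrib matrix_vector_mul_assoc)
      moreover have "norm (N *v (N *v x)) \<le> norm x"
        using N order.trans unfolding K_def by blast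
      ultimately show ?thesis
        using contr[of x] by simp
    qed
    moreover have "ctranspose (f N) = f N"
      using N herm by (simp add: f_def K_def ctranspose_scaleR ctranspose_add ctranspose_matrix_mult)
    ultimately show "f N \<in> K"
      by (simp add: K_def)
  qed
  ultimately obtain N where "N \<in> K" "f N = N"
    using brouwer[of K f] by auto
  moreover have "2 *\<^sub>R f N = M + N ** N"
    by (simp add: f_def)
  ultimately have "N \<in> K" "2 *\<^sub>R N = M + N ** N"
    by simp_all
  then show ?thesis
    using that by (auto simp: K_def)
qed

text \<open>
  After scaling by the square of a bound \<open>k\<close> for \<open>Y*\<close>, the matrix
  \<open>1 - Y* Y / k^2\<close> is a contraction, so that the previous lemma applies.
\<close>

lemma gram_square_root:
  fixes Y :: "'a::hermitian_scalar^'m^'p"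
  obtains S where "ctranspose S = S" "S ** S = ctranspose Y ** Y"
proof -
  define W where "W = ctranspose Y ** Y"
  obtain k where k: "k > 0" "\<And>y. norm (ctranspose Y *v y) \<le> norm y * k"
    using bounded_linear.pos_bounded[OF matrix_vector_mul_bounded_linear[of "ctranspose Y"]] by blast
  define M where "M = mat 1 - (1 / k\<^sup>2) *\<^sub>R W"
  have hW: "ctranspose W = W"
    by (simp add: W_def ctranspose_matrix_mult)
  have "ctranspose M = M"
    using linear_diff[OF linear_ctranspose, of "mat 1" "(1 / k\<^sup>2) *\<^sub>R W"]
    by (simp add: M_def ctranspose_scaleR hW)
  moreover have "norm (M *v x) \<le> norm x" for x
  proof -
    have inW: "inner x (W *v x) = (norm (Y *v x))\<^sup>2"
      by (simp add: W_def matrix_vector_mul_assoc[symmetric] power2_norm_eq_inner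
          inner_matrix_vector_mult_left)
    have "norm (W *v x) \<le> norm (Y *v x) * k"
      by (simp add: W_def matrix_vector_mul_assoc[symmetric] k)
    then have "(norm (W *v x))\<^sup>2 \<le> (norm (Y *v x) * k)\<^sup>2"
      by (rule power_mono) simp
    then have le: "(norm (W *v x))\<^sup>2 / k ^ 4 \<le> (norm (Y *v x))\<^sup>2 / k\<^sup>2"
      using k(1) by (simp add: field_simps power2_eq_square power4_eq_xxxx)
    have "M *v x = x - (1 / k\<^sup>2) *\<^sub>R (W *v x)"
      by (simp add: M_def matrix_vector_mult_diff_rdistrib scaleR_matrix_vector)
    moreover have "(norm (x - c *\<^sub>R y))\<^sup>2 = (norm x)\<^sup>2 - 2 * (c * inner x y) + c\<^sup>2 * (norm y)\<^sup>2" for c and y :: "'a^'m"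
      unfolding power2_norm_eq_inner
      by (simp add: inner_diff_left inner_diff_right inner_commute power2_eq_square algebra_simps)
    ultimately have "(norm (M *v x))\<^sup>2 = (norm x)\<^sup>2 - 2 * (inner x (W *v x) / k\<^sup>2) + (norm (W *v x))\<^sup>2 / k ^ 4"
      by (simp add: power_divide)
    also have "\<dots> \<le> (norm x)\<^sup>2"
      using le zero_le_power2[of "norm (Y *v x) / k"] unfolding inW power_divide by linarith
    finally show ?thesis
      by (rule power2_le_imp_le) simp
  qed
  ultimately obtain N where N: "ctranspose N = N" "2 *\<^sub>R N = M + N ** N"
    by (rule hermitian_fixed_point)
  define S where "S = k *\<^sub>R (mat 1 - N)"
  have "ctranspose S = S"
    using linear_diff[OF linear_ctranspose, of "mat 1" N] N
    by (simp add: S_def ctranspose_scaleR)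
  moreover have "S ** S = W"
  proof -
    have "(mat 1 - N) ** (mat 1 - N) = mat 1 - 2 *\<^sub>R N + N ** N"
      by (simp add: matrix_diff_ldistrib matrix_diff_rdistrib scaleR_2)
    also have "\<dots> = (1 / k\<^sup>2) *\<^sub>R W"
      by (simp add: N(2) M_def)
    finally show ?thesis
      using k(1) by (simp add: S_def scaleR_matrix_mult matrix_scalar_ac power2_eq_square)
  qed
  ultimately show ?thesis
    using that by (simp add: W_def)
qed

section \<open>Inverses and Moore--Penrose inverses\<close>

lemma matrix_eq_axis: "A = B \<longleftrightarrow> (\<forall>j. A *v axis j 1 = B *v axis j (1::'a::semiring_1))"
  by (auto simp: vec_eq_iff matrix_axis_nth)

text \<open>
  A real linear injection of a space into itself is onto, so columns of a right inverse exist.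
\<close>

lemma injective_square_matrix_invertible:
  fixes W :: "'a::hermitian_scalar^'m^'m"
  assumes inj: "inj ((*v) W)"
  obtains V where "W ** V = mat 1" "V ** W = mat 1"
proof -
  have "surj ((*v) W)"
    by (rule linear_injective_imp_surjective[OF matrix_vector_mul_linear inj refl])
  then have "\<forall>j. \<exists>x. W *v x = axis j 1"
    by (metis surjD)
  then obtain g where g: "\<And>j. W *v g j = axis j 1"
    by metis
  define V where "V = (\<chi> i j. g j $ i)"
  have "V *v axis j 1 = g j" for j
    by (simp add: vec_eq_iff matrix_axis_nth V_def)
  then have WV: "W ** V = mat 1"
    by (simp add: matrix_eq_axis g flip: matrix_vector_mul_assoc)
  have "W *v ((V ** W) *v x) = W *v x" for x
    by (simp add: matrix_vector_mul_assoc matrix_mul_assoc WV)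
  then have "V ** W = mat 1"
    using inj by (auto simp: matrix_eq dest: injD)
  with WV that show ?thesis by blast
qed

lemma matrix_inv_eqI:
  fixes W :: "'a::semiring_1^'m^'n"
  assumes "W ** V = mat 1" "V ** W = mat 1"
  shows "matrix_inv W = V"
  unfolding matrix_inv_def
proof (rule some_equality)
  fix V' assume "W ** V' = mat 1 \<and> V' ** W = mat 1"
  then show "V' = V"
    using assms by (metis matrix_mul_assoc matrix_mul_lid matrix_mul_rid)
qed (use assms in blast)

text \<open>
  The classical argument: both \<open>A G\<close> and \<open>A H\<close> are the orthogonal
  projection onto the range of \<open>A\<close>, and likewise on the other side.
\<close>

lemma moore_penrose_unique:
  assumes G: "is_moore_penrose A G" and H: "is_moore_penrose A H"
  shows "G = H"
proof -
  note g = G[unfolded is_moore_penrose_def] and h = H[unfolded is_moore_penrose_def]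
  have 1: "A ** G = A ** H"
  proof -
    have "A ** G = ctranspose (A ** G)" using g by simp
    also have "\<dots> = ctranspose ((A ** H) ** (A ** G))"
      using h by (simp add: matrix_mul_assoc)
    also have "\<dots> = (A ** G) ** (A ** H)"
      using g h by (subst ctranspose_matrix_mult) simp
    also have "\<dots> = A ** H"
      using g by (simp add: matrix_mul_assoc)
    finally show ?thesis .
  qed
  have 2: "G ** A = H ** A"
  proof -
    have "G ** A = ctranspose (G ** A)" using g by simp
    also have "\<dots> = ctranspose ((G ** A) ** (H ** A))"
      using h by (metis matrix_mul_assoc)
    also have "\<dots> = (H ** A) ** (G ** A)"
      using g h by (subst ctranspose_matrix_mult) simp
    also have "\<dots> = H ** A"
      using g by (metis matrix_mul_assoc)
    finally show ?thesis .
  qed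
  have "G = G ** (A ** G)" using g by (simp add: matrix_mul_assoc)
  also have "\<dots> = (G ** A) ** H" by (simp add: 1 matrix_mul_assoc)
  also have "\<dots> = H" using h by (simp add: 2)
  finally show ?thesis .
qed

lemma moore_penrose_inv_eqI: "is_moore_penrose A G \<Longrightarrow> moore_penrose_inv A = G"
  unfolding moore_penrose_inv_def by (rule the_equality) (auto intro: moore_penrose_unique)

section \<open>Real eigenvalues\<close>

text \<open>
  Real scalars are central, so for them right eigenvectors are the eigenvectors of a real linear
  map.
\<close>

lemma right_eigenvalue_of_real:
  "right_eigenvalue M (of_real r) \<longleftrightarrow> (\<exists>x. x \<noteq> 0 \<and> M *v x = r *\<^sub>R x)"
proof -
  have "(\<chi> i. x $ i * of_real r) = r *\<^sub>R x" for x :: "'a^'b"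
    by (simp add: vec_eq_iff of_real_def)
  then show ?thesis by (simp add: right_eigenvalue_def)
qed

text \<open>
  Applying \<open>f - s\<close> to a relation kills the eigenvector for \<open>s\<close> and
  multiplies the others by \<open>r - s \<noteq> 0\<close>.
\<close>

lemma eigenvectors_linearly_independent:
  fixes f :: "'a::real_vector \<Rightarrow> 'a"
  assumes "linear f" "finite \<Lambda>"
    and "\<And>r. r \<in> \<Lambda> \<Longrightarrow> v r \<noteq> 0" "\<And>r. r \<in> \<Lambda> \<Longrightarrow> f (v r) = r *\<^sub>R v r"
    and "(\<Sum>r\<in>\<Lambda>. c r *\<^sub>R v r) = 0"
  shows "\<forall>r\<in>\<Lambda>. c r = 0"
  using assms(2-)
proof (induction \<Lambda> arbitrary: c)
  case (insert s \<Lambda>)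
  have sum0: "c s *\<^sub>R v s + (\<Sum>r\<in>\<Lambda>. c r *\<^sub>R v r) = 0"
    using insert.hyps insert.prems(3) by simp
  then have "f (c s *\<^sub>R v s + (\<Sum>r\<in>\<Lambda>. c r *\<^sub>R v r)) - s *\<^sub>R (c s *\<^sub>R v s + (\<Sum>r\<in>\<Lambda>. c r *\<^sub>R v r)) = 0"
    by (simp only: linear_0[OF assms(1)] scaleR_zero_right diff_self)
  moreover have "f (\<Sum>r\<in>\<Lambda>. c r *\<^sub>R v r) = (\<Sum>r\<in>\<Lambda>. (c r * r) *\<^sub>R v r)"
    using insert.prems(2) by (simp add: linear_sum[OF assms(1)] linear_scale[OF assms(1)])
  ultimately have "(\<Sum>r\<in>\<Lambda>. (c r * (r - s)) *\<^sub>R v r) = 0"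
    using insert.prems(2)[of s]
    by (simp add: linear_add[OF assms(1)] linear_scale[OF assms(1)] algebra_simps sum_subtractf scaleR_sum_right)
  then have "\<forall>r\<in>\<Lambda>. c r * (r - s) = 0"
    using insert.prems by (intro insert.IH) auto
  then have "\<forall>r\<in>\<Lambda>. c r = 0"
    using insert.hyps(2) by auto
  then show ?case
    using sum0 insert.prems(1) by simp
qed simp

lemma finite_real_eigenvalues_linear:
  fixes f :: "'a::euclidean_space \<Rightarrow> 'a"
  assumes f: "linear f"
  shows "finite {r. \<exists>x. x \<noteq> 0 \<and> f x = r *\<^sub>R x}" (is "finite ?E")
proof (rule ccontr)
  assume "infinite ?E"
  then obtain \<Lambda> where \<Lambda>: "finite \<Lambda>" "card \<Lambda> = Suc DIM('a)" "\<Lambda> \<subseteq> ?E"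
    using infinite_arbitrarily_large by blast
  from \<Lambda>(3) have "\<forall>r\<in>\<Lambda>. \<exists>x. x \<noteq> 0 \<and> f x = r *\<^sub>R x"
    by auto
  then obtain v where v: "\<And>r. r \<in> \<Lambda> \<Longrightarrow> v r \<noteq> 0" "\<And>r. r \<in> \<Lambda> \<Longrightarrow> f (v r) = r *\<^sub>R v r"
    by metis
  have inj: "inj_on v \<Lambda>"
    by (rule inj_onI) (metis v scaleR_right_imp_eq)
  have "independent (v ` \<Lambda>)"
  proof (rule independent_if_scalars_zero)
    fix c x assume "(\<Sum>x\<in>v ` \<Lambda>. c x *\<^sub>R x) = 0" "x \<in> v ` \<Lambda>"
    then show "c x = 0"
      using eigenvectors_linearly_independent[OF f \<Lambda>(1) v, of "\<lambda>r. c (v r)"] inj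
      by (auto simp: sum.reindex)
  qed (use \<Lambda> in simp)
  then have "card (v ` \<Lambda>) \<le> DIM('a)"
    using independent_bound by blast
  then show False
    using \<Lambda> inj by (simp add: card_image)
qed

lemma finite_real_right_eigenvalues:
  fixes M :: "'a::hermitian_scalar^'m^'m"
  shows "finite {r. right_eigenvalue M (of_real r)}"
  using finite_real_eigenvalues_linear[OF matrix_vector_mul_linear, of M]
  by (simp add: right_eigenvalue_of_real)

section \<open>Comparison of the largest eigenvalues for given matrices\<close>

text \<open>
  Comparing real dimensions suffices.
\<close>

lemma exists_kernel_vector:
  fixes Q :: "'a::hermitian_scalar^'p^'m"
  assumes "CARD('m) < CARD('p)"
  obtains x where "x \<noteq> 0" "Q *v x = 0"
proof -
  have "\<not> inj ((*v) Q)"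
  proof
    assume "inj ((*v) Q)"
    then have "dim ((*v) Q ` UNIV) = dim (UNIV :: ('a^'p) set)"
      by (intro dim_image_eq[OF matrix_vector_mul_linear]) simp
    moreover have "dim ((*v) Q ` UNIV) \<le> DIM('a^'m)"
      by (rule dim_subset_UNIV)
    ultimately show False
      using assms by simp
  qed
  then show ?thesis
    using linear_injective_0[OF matrix_vector_mul_linear, of Q] that by blast
qed

lemma eigenvalue_swap_nonzero:
  fixes P :: "'a::hermitian_scalar^'m^'p" and Q :: "'a^'p^'m"
  assumes "right_eigenvalue (P ** Q) (of_real r)" "r \<noteq> 0"
  shows "right_eigenvalue (Q ** P) (of_real r)"
proof -
  obtain x where x: "x \<noteq> 0" "P *v (Q *v x) = r *\<^sub>R x"
    using assms(1) by (auto simp: right_eigenvalue_of_real matrix_vector_mul_assoc)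
  then have "Q *v x \<noteq> 0"
    using assms(2) by auto
  moreover have "(Q ** P) *v (Q *v x) = r *\<^sub>R (Q *v x)"
    by (simp only: matrix_vector_mul_assoc[symmetric] x matrix_vector_scaleR)
  ultimately show ?thesis
    by (auto simp: right_eigenvalue_of_real)
qed

text \<open>
  The sets of real eigenvalues, over which the maximum is taken, coincide. The eigenvalue
  \<open>0\<close> has to be assumed because swapping the factors preserves only nonzero
  eigenvalues.
\<close>

lemma largest_eigenvalue_swap:
  fixes P :: "'a::hermitian_scalar^'m^'p" and Q :: "'a^'p^'m"
  assumes "right_eigenvalue (P ** Q) 0" "right_eigenvalue (Q ** P) 0"
  shows "largest_eigenvalue (P ** Q) = largest_eigenvalue (Q ** P)"
proof -
  have "right_eigenvalue (P ** Q) (of_real r) = right_eigenvalue (Q ** P) (of_real r)" for r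
    using assms eigenvalue_swap_nonzero[of P Q r] eigenvalue_swap_nonzero[of Q P r]
    by (cases "r = 0") auto
  then show ?thesis
    by (simp add: largest_eigenvalue_def)
qed

text \<open>
  Here \<open>H = Y S^-1\<close> for a Hermitian square root \<open>S\<close> of
  \<open>Y* Y\<close>. It is important that \<open>S\<close> is Hermitian: for a general
  factorization \<open>Y = H T\<close> with \<open>H* H = 1\<close> the last factor on the right
  would be the inverse of \<open>T T*\<close> instead of \<open>T* T = Y* Y\<close>. The matrix
  \<open>H\<close> depends on \<open>Y\<close> only, so it is fixed while \<open>X\<close> varies.
\<close>

lemma largest_eigenvalue_reduction:
  fixes Y :: "'a::hermitian_scalar^'m^'p"
  assumes inj: "inj ((*v) Y)" and nm: "CARD('n) < CARD('m)" and mp: "CARD('m) < CARD('p)"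
  obtains H :: "'a^'m^'p" where "ctranspose H ** H = mat 1"
    "\<And>X :: 'a^'n^'p.
        largest_eigenvalue ((X ** ctranspose X) ** moore_penrose_inv (Y ** ctranspose Y)) =
        largest_eigenvalue (((ctranspose H ** X) ** ctranspose (ctranspose H ** X)) **
          matrix_inv (ctranspose Y ** Y))"
proof -
  define W where "W = ctranspose Y ** Y"
  have "x = 0" if "W *v x = 0" for x
  proof -
    have "inner (Y *v x) (Y *v x) = inner x (W *v x)"
      by (simp add: W_def inner_matrix_vector_mult_left matrix_vector_mul_assoc)
    then have "Y *v x = 0"
      using that by simp
    then show ?thesis
      using inj linear_injective_0[OF matrix_vector_mul_linear, of Y] by blast
  qed
  then have "inj ((*v) W)"
    using linear_injective_0[OF matrix_vector_mul_linear, of W] by blast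
  then obtain V where V: "W ** V = mat 1" "V ** W = mat 1"
    by (rule injective_square_matrix_invertible)
  obtain S where S: "ctranspose S = S" "S ** S = W"
    unfolding W_def by (rule gram_square_root)
  \<comment> \<open>\<open>C\<close> is the inverse of \<open>S\<close>, obtained from \<open>S^2 = W\<close> and \<open>V = W^-1\<close>.\<close>
  define C where "C = V ** S"
  have CS: "C ** S = mat 1"
    by (simp add: C_def S V flip: matrix_mul_assoc)
  have SC: "S ** C = mat 1"
  proof -
    have "S ** V = V ** S"
      by (metis S(2) V matrix_mul_assoc matrix_mul_lid matrix_mul_rid)
    then show ?thesis
      by (metis C_def S(2) V(1) matrix_mul_assoc)
  qed
  have hC: "ctranspose C = C"
  proof -
    have "S ** ctranspose C = mat 1"
      by (metis CS S(1) ctranspose_mat_one ctranspose_matrix_mult)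
    then show ?thesis
      by (metis CS matrix_mul_assoc matrix_mul_lid matrix_mul_rid)
  qed
  have CC: "C ** C = V"
    by (metis CS C_def S(2) V(1) matrix_mul_assoc matrix_mul_lid matrix_mul_rid)
  define H where "H = Y ** C"
  have HH: "ctranspose H ** H = mat 1"
  proof -
    have "ctranspose H ** H = C ** W ** C"
      by (simp add: H_def hC ctranspose_matrix_mult W_def matrix_mul_assoc)
    also have "\<dots> = (C ** S) ** (S ** C)"
      by (simp add: S(2)[symmetric] matrix_mul_assoc)
    finally show ?thesis
      by (simp add: CS SC)
  qed
  have hV: "ctranspose V = V"
    by (metis CC hC ctranspose_matrix_mult)
  have Y: "Y = H ** S"
    by (simp add: H_def CS flip: matrix_mul_assoc)
  define B where "B = Y ** ctranspose Y"
  define G where "G = H ** V ** ctranspose H"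
  have B: "B = H ** W ** ctranspose H"
    unfolding B_def Y ctranspose_matrix_mult S by (simp add: S(2)[symmetric] matrix_mul_assoc)
  \<comment> \<open>\<open>M \<mapsto> H M H*\<close> is multiplicative, so it carries the inverse of \<open>W\<close> to the Moore--Penrose inverse.\<close>
  have core: "(H ** M ** ctranspose H) ** (H ** N ** ctranspose H) = H ** (M ** N) ** ctranspose H"
    for M N :: "'a^'m^'m"
  proof -
    have "(H ** M ** ctranspose H) ** (H ** N ** ctranspose H)
        = H ** M ** (ctranspose H ** H) ** N ** ctranspose H"
      by (simp only: matrix_mul_assoc)
    then show ?thesis
      by (simp add: HH matrix_mul_assoc)
  qed
  have "is_moore_penrose B G"
    unfolding is_moore_penrose_def B G_def core V
    by (simp add: ctranspose_matrix_mult matrix_mul_assoc V)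
  then have mp_eq: "moore_penrose_inv B = G"
    by (rule moore_penrose_inv_eqI)
  have inv_eq: "matrix_inv W = V"
    by (rule matrix_inv_eqI) (fact V)+
  show ?thesis
  proof (rule that[OF HH])
    fix X :: "'a^'n^'p"
    define P where "P = X ** ctranspose X ** H ** V"
    have PQ: "(X ** ctranspose X) ** moore_penrose_inv (Y ** ctranspose Y) = P ** ctranspose H"
      unfolding B_def[symmetric] mp_eq by (simp add: P_def G_def matrix_mul_assoc)
    have QP: "((ctranspose H ** X) ** ctranspose (ctranspose H ** X)) ** matrix_inv (ctranspose Y ** Y)
        = ctranspose H ** P"
      unfolding W_def[symmetric] inv_eq by (simp add: P_def ctranspose_matrix_mult matrix_mul_assoc)
    \<comment> \<open>Zero eigenvalues: \<open>H*\<close> has a kernel as \<open>m < p\<close>, and \<open>X* H V\<close> has one as \<open>n < m\<close>.\<close>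
    obtain x :: "'a^'p" where x: "x \<noteq> 0" "ctranspose H *v x = 0"
      by (rule exists_kernel_vector[OF mp, of "ctranspose H"])
    have "right_eigenvalue (P ** ctranspose H) (of_real 0)"
      unfolding right_eigenvalue_of_real
      by (rule exI[of _ x]) (simp add: x flip: matrix_vector_mul_assoc)
    moreover obtain y :: "'a^'m" where y: "y \<noteq> 0" "(ctranspose X ** H ** V) *v y = 0"
      by (rule exists_kernel_vector[OF nm, of "ctranspose X ** H ** V"])
    have "(ctranspose H ** P) *v y = (ctranspose H ** X) *v ((ctranspose X ** H ** V) *v y)"
      by (simp add: P_def matrix_vector_mul_assoc matrix_mul_assoc)
    then have "right_eigenvalue (ctranspose H ** P) (of_real 0)"
      unfolding right_eigenvalue_of_real
      by (intro exI[of _ y]) (simp add: y)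
    ultimately show "largest_eigenvalue ((X ** ctranspose X) ** moore_penrose_inv (Y ** ctranspose Y)) =
        largest_eigenvalue (((ctranspose H ** X) ** ctranspose (ctranspose H ** X)) **
          matrix_inv (ctranspose Y ** Y))"
      unfolding PQ QP by (intro largest_eigenvalue_swap) simp_all
  qed
qed

section \<open>Borel measurability of inverses and of the largest eigenvalue\<close>

text \<open>
  The projection is a countable union of projections along compact balls, each of which is closed.
\<close>

lemma borel_projection_of_closed:
  fixes T :: "('b::euclidean_space \<times> 'a::euclidean_space) set"
  assumes "closed T"
  shows "{x. \<exists>y. (y, x) \<in> T} \<in> sets borel"
proof -
  have "closed {x. \<exists>y. y \<in> cball 0 (real n) \<and> (y, x) \<in> T}" for n :: nat
    by (rule closed_compact_projection[OF compact_cball assms])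
  then have "(\<Union>n::nat. {x. \<exists>y. y \<in> cball 0 (real n) \<and> (y, x) \<in> T}) \<in> sets borel"
    by (intro sets.countable_UN) (auto intro: borel_closed)
  also have "(\<Union>n::nat. {x. \<exists>y. y \<in> cball 0 (real n) \<and> (y, x) \<in> T}) = {x. \<exists>y. (y, x) \<in> T}"
  proof safe
    fix x y assume "(y, x) \<in> T"
    moreover obtain n :: nat where "norm y \<le> real n"
      using real_arch_simple by blast
    ultimately show "x \<in> (\<Union>n::nat. {x. \<exists>y. y \<in> cball 0 (real n) \<and> (y, x) \<in> T})"
      by auto
  qed auto
  finally show ?thesis .
qed

text \<open>
  For partial operations made total by a default value \<open>d\<close>, such as inverses defined
  by a description: the preimage of a closed set is a projection of a closed set, up to the
  complement of the domain, which is a projection itself.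
\<close>

lemma borel_measurable_of_closed_graph:
  fixes R :: "'a::euclidean_space \<Rightarrow> 'b::euclidean_space \<Rightarrow> bool"
  assumes clo: "closed {(y, x). R x y}"
    and f: "\<And>x y. R x y \<Longrightarrow> f x = y" and d: "\<And>x. \<nexists>y. R x y \<Longrightarrow> f x = d"
  shows "f \<in> borel_measurable borel"
  unfolding borel_eq_closed[where 'a='b]
proof (rule measurable_measure_of)
  fix C :: "'b set" assume "C \<in> Collect closed"
  then have C: "closed C" by simp
  have "closed ({(y, x). R x y} \<inter> C \<times> UNIV)"
    by (intro closed_Int clo closed_Times C closed_UNIV)
  from borel_projection_of_closed[OF this] borel_projection_of_closed[OF clo]
  have [measurable]: "{x. \<exists>y. R x y \<and> y \<in> C} \<in> sets borel" "{x. \<exists>y. R x y} \<in> sets borel"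
    by simp_all
  have "f -` C = {x. \<exists>y. R x y \<and> y \<in> C} \<union> (if d \<in> C then - {x. \<exists>y. R x y} else {})"
  proof (rule set_eqI)
    fix x
    show "x \<in> f -` C \<longleftrightarrow> x \<in> {x. \<exists>y. R x y \<and> y \<in> C} \<union> (if d \<in> C then - {x. \<exists>y. R x y} else {})"
      using f[of x] d[of x] by (cases "\<exists>y. R x y") auto
  qed
  also have "\<dots> \<in> sets borel"
    by (cases "d \<in> C") (auto intro!: sets.Un borel_comp)
  finally show "f -` C \<inter> space borel \<in> sets borel"
    by simp
qed auto

lemma borel_measurable_moore_penrose_inv:
  "(moore_penrose_inv :: 'a::hermitian_scalar^'n^'m \<Rightarrow> 'a^'m^'n) \<in> borel_measurable borel"
proof (rule borel_measurable_of_closed_graph)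
  show "closed {(G, A :: 'a^'n^'m). is_moore_penrose A G}"
    unfolding is_moore_penrose_def case_prod_beta Collect_conj_eq
    by (intro closed_Int closed_Collect_eq continuous_intros)
  show "moore_penrose_inv A = (THE G. False)" if "\<nexists>G. is_moore_penrose A G" for A :: "'a^'n^'m"
    using that by (simp add: moore_penrose_inv_def)
qed (rule moore_penrose_inv_eqI)

lemma borel_measurable_matrix_inv:
  "(matrix_inv :: 'a::hermitian_scalar^'n^'m \<Rightarrow> 'a^'m^'n) \<in> borel_measurable borel"
proof (rule borel_measurable_of_closed_graph)
  show "closed {(V, A :: 'a^'n^'m). A ** V = mat 1 \<and> V ** A = mat 1}"
    unfolding case_prod_beta Collect_conj_eq
    by (intro closed_Int closed_Collect_eq continuous_intros)
  show "matrix_inv A = V" if "A ** V = mat 1 \<and> V ** A = mat 1" for A :: "'a^'n^'m" and V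
    using that by (simp add: matrix_inv_eqI)
  show "matrix_inv A = (SOME V. False)" if "\<nexists>V. A ** V = mat 1 \<and> V ** A = mat 1" for A :: "'a^'n^'m"
  proof -
    have "(A ** V = mat 1 \<and> V ** A = mat 1) = False" for V
      using that by blast
    then show ?thesis
      by (simp only: matrix_inv_def)
  qed
qed

text \<open>
  Where there are real eigenvalues, finiteness makes \<open>GREATEST\<close> a maximum, so its
  superlevel sets are projections of closed sets of triples (eigenvalue, unit eigenvector,
  matrix). Elsewhere the value is one fixed, unspecified number.
\<close>

lemma borel_measurable_largest_eigenvalue:
  "(largest_eigenvalue :: 'a::hermitian_scalar^'m^'m \<Rightarrow> real) \<in> borel_measurable borel"
  unfolding borel_measurable_iff_ge
proof safe
  fix t :: real
  let ?E = "\<lambda>M :: 'a^'m^'m. {r. right_eigenvalue M (of_real r)}"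
  have ge: "{M. \<exists>r\<in>?E M. s r} \<in> sets borel" if s: "closed {r. s r}" for s
  proof -
    have eq: "{M. \<exists>r\<in>?E M. s r} = {M. \<exists>p. (p, M) \<in> {(p, M). s (fst p) \<and> norm (snd p) = 1 \<and> M *v snd p = fst p *\<^sub>R snd p}}"
    proof safe
      fix M :: "'a^'m^'m" and r assume "s r" "right_eigenvalue M (of_real r)"
      then obtain x where "x \<noteq> 0" "M *v x = r *\<^sub>R x"
        by (auto simp: right_eigenvalue_of_real)
      with \<open>s r\<close> show "\<exists>p. (p, M) \<in> {(p, M). s (fst p) \<and> norm (snd p) = 1 \<and> M *v snd p = fst p *\<^sub>R snd p}"
        by (intro exI[of _ "(r, x /\<^sub>R norm x)"]) (simp add: matrix_vector_scaleR scaleR_left_commute)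
    next
      fix M :: "'a^'m^'m" and r x assume "s (fst (r, x))" "norm (snd (r, x)) = 1" "M *v snd (r, x) = fst (r, x) *\<^sub>R snd (r, x)"
      then show "\<exists>r\<in>?E M. s r"
        by (intro bexI[of _ r]) (auto simp: right_eigenvalue_of_real intro!: exI[of _ x])
    qed
    have clo: "closed {(p, M :: 'a^'m^'m). s (fst p) \<and> norm (snd p) = 1 \<and> M *v snd p = fst p *\<^sub>R snd p}"
    proof -
      have "closed {p :: (real \<times> ('a^'m)) \<times> ('a^'m^'m). s (fst (fst p))}"
        using continuous_closed_vimage[OF s, of "\<lambda>p :: (real \<times> ('a^'m)) \<times> ('a^'m^'m). fst (fst p)"]
        by (simp add: vimage_def)
      then show ?thesis
        unfolding case_prod_beta Collect_conj_eq
        by (intro closed_Int closed_Collect_eq continuous_intros)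
    qed
    show ?thesis
      unfolding eq by (rule borel_projection_of_closed[OF clo])
  qed
  let ?d = "GREATEST r::real. False"
  have empty: "largest_eigenvalue M = ?d" if "?E M = {}" for M :: "'a^'m^'m"
    using that by (simp add: largest_eigenvalue_def)
  have Max: "largest_eigenvalue M = Max (?E M)" if "?E M \<noteq> {}" for M :: "'a^'m^'m"
    unfolding largest_eigenvalue_def
    using Max_in[OF finite_real_right_eigenvalues that] Max_ge[OF finite_real_right_eigenvalues]
    by (intro Greatest_equality) auto
  have nonempty: "t \<le> largest_eigenvalue M \<longleftrightarrow> (\<exists>r\<in>?E M. t \<le> r)" if "?E M \<noteq> {}" for M :: "'a^'m^'m"
    unfolding Max[OF that] using that by (rule Max_ge_iff[OF finite_real_right_eigenvalues])
  have "{M :: 'a^'m^'m. t \<le> largest_eigenvalue M} =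
      {M. \<exists>r\<in>?E M. t \<le> r} \<union> (if t \<le> ?d then - {M. \<exists>r\<in>?E M. True} else {})"
  proof (rule set_eqI)
    fix M :: "'a^'m^'m"
    show "M \<in> {M. t \<le> largest_eigenvalue M} \<longleftrightarrow>
        M \<in> {M. \<exists>r\<in>?E M. t \<le> r} \<union> (if t \<le> ?d then - {M. \<exists>r\<in>?E M. True} else {})"
    proof (cases "?E M = {}")
      case True
      then show ?thesis using empty[OF True] by auto
    next
      case False
      then show ?thesis using nonempty[OF False] by auto
    qed
  qed
  also have "\<dots> \<in> sets borel"
  proof -
    have "{M. \<exists>r\<in>?E M. t \<le> r} \<in> sets borel" "{M. \<exists>r\<in>?E M. True} \<in> sets borel"
      by (rule ge, intro closed_Collect_le continuous_intros, rule ge, simp)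
    then show ?thesis
      by (cases "t \<le> ?d") (auto simp del: bex_simps intro!: sets.Un borel_comp)
  qed
  finally show "{M \<in> space borel. t \<le> (largest_eigenvalue M :: real)} \<in> sets (borel :: ('a^'m^'m) measure)"
    by simp
qed

section \<open>Matrices that are not injective form a null set\<close>

text \<open>
  By translation invariance, the measure of \<open>S\<close> is the average over
  \<open>0 \<le> t \<le> 1\<close> of the measures of \<open>S - t e\<close>; by Fubini's theorem
  this is an integral of one-dimensional sections, which are null.
\<close>

lemma null_sets_lborel_of_line_sections:
  fixes S :: "'a::euclidean_space set"
  assumes [measurable]: "S \<in> sets borel" and fin: "\<And>x. finite {t. x + t *\<^sub>R e \<in> S}"
  shows "S \<in> null_sets lborel"
proof -
  have line: "{t. x + t *\<^sub>R e \<in> S} \<in> null_sets lborel" for x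
    by (rule finite_imp_null_set_lborel[OF fin])
  have "(\<integral>\<^sup>+x. (\<integral>\<^sup>+t. indicator {0..1::real} t * indicator S (x + t *\<^sub>R e) \<partial>lborel) \<partial>lborel) = 0"
  proof -
    have "(\<integral>\<^sup>+t. indicator {0..1::real} t * indicator S (x + t *\<^sub>R e) \<partial>lborel) = 0" for x
      by (subst nn_integral_0_iff_AE)
         (auto intro!: AE_I'[OF line[of x]] simp: indicator_def)
    then show ?thesis by simp
  qed
  then have "0 = (\<integral>\<^sup>+t. (\<integral>\<^sup>+x. indicator {0..1::real} t * indicator S (x + t *\<^sub>R e) \<partial>lborel) \<partial>lborel)"
    by (subst (asm) lborel_pair.Fubini') simp_all
  also have "\<dots> = (\<integral>\<^sup>+t. indicator {0..1::real} t * emeasure lborel S \<partial>lborel)"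
  proof (rule nn_integral_cong)
    fix t :: real
    have "(\<integral>\<^sup>+x. indicator S (t *\<^sub>R e + x) \<partial>lborel) = (\<integral>\<^sup>+x. indicator S x \<partial>distr lborel borel ((+) (t *\<^sub>R e)))"
      by (rule nn_integral_distr[symmetric]) auto
    then show "(\<integral>\<^sup>+x. indicator {0..1::real} t * indicator S (x + t *\<^sub>R e) \<partial>lborel)
        = indicator {0..1::real} t * emeasure lborel S"
      by (simp add: nn_integral_cmult add.commute lborel_distr_plus)
  qed
  also have "\<dots> = emeasure lborel S"
    by (simp add: nn_integral_multc)
  finally show ?thesis
    by (auto simp: null_sets_def)
qed

text \<open>
  On a line \<open>Y + t E\<close> with \<open>E* E = 1\<close>, a vector in the kernel is an
  eigenvector of \<open>E* Y\<close> for \<open>-t\<close>, so only finitely many \<open>t\<close>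
  are exceptional.
\<close>

lemma null_sets_lborel_not_injective:
  assumes le: "CARD('m) \<le> CARD('p)"
  shows "{Y :: 'a::hermitian_scalar^'m^'p. \<not> inj ((*v) Y)} \<in> null_sets lborel" (is "?S \<in> _")
proof -
  obtain j :: "'m \<Rightarrow> 'p" where j: "inj j"
    using le by (metis card_le_inj finite_class.finite_UNIV)
  \<comment> \<open>\<open>E\<close> embeds the coordinates along \<open>j\<close>, so that its columns are orthonormal.\<close>
  define E :: "'a^'m^'p" where "E = (\<chi> i k. if i = j k then 1 else 0)"
  have EE: "ctranspose E ** E = mat 1"
  proof -
    have "(\<Sum>i\<in>UNIV. hconj (E $ i $ k) * E $ i $ l) = (if k = l then 1 else 0)" for k l
    proof -
      have "(\<Sum>i\<in>UNIV. hconj (E $ i $ k) * E $ i $ l) = (\<Sum>i\<in>UNIV. if i = j k then (if k = l then 1 else 0) else 0)"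
        using j by (intro sum.cong refl) (auto simp: E_def dest: injD)
      then show ?thesis by simp
    qed
    then show ?thesis
      by (simp add: vec_eq_iff matrix_matrix_mult_def mat_def)
  qed
  have noninj: "?S = {Y. \<exists>x. x \<noteq> 0 \<and> Y *v x = 0}"
    using linear_injective_0[OF matrix_vector_mul_linear] by blast
  have eq: "?S = {Y. \<exists>x. (x, Y) \<in> {(x, Y). norm x = 1 \<and> Y *v x = 0}}"
    unfolding noninj
  proof safe
    fix Y :: "'a^'m^'p" and x assume "x \<noteq> 0" "Y *v x = 0"
    then show "\<exists>x. (x, Y) \<in> {(x, Y). norm x = 1 \<and> Y *v x = 0}"
      by (intro exI[of _ "x /\<^sub>R norm x"]) (simp add: matrix_vector_scaleR)
  next
    fix Y :: "'a^'m^'p" and x assume "norm x = 1" "Y *v x = 0"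
    then show "\<exists>x. x \<noteq> 0 \<and> Y *v x = 0"
      by (intro exI[of _ x]) auto
  qed
  have clo: "closed {(x, Y :: 'a^'m^'p). norm x = 1 \<and> Y *v x = 0}"
    unfolding case_prod_beta Collect_conj_eq
    by (intro closed_Int closed_Collect_eq continuous_intros)
  have "?S \<in> sets borel"
    unfolding eq by (rule borel_projection_of_closed[OF clo])
  moreover have "finite {t. Y + t *\<^sub>R E \<in> ?S}" for Y
  proof -
    have "{t. Y + t *\<^sub>R E \<in> ?S} \<subseteq> uminus ` {r. \<exists>x. x \<noteq> 0 \<and> (ctranspose E ** Y) *v x = r *\<^sub>R x}"
      unfolding noninj
    proof safe
      fix t x assume "x \<noteq> 0" "(Y + t *\<^sub>R E) *v x = 0"
      then have "ctranspose E *v (Y *v x + t *\<^sub>R (E *v x)) = 0"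
        by (simp add: matrix_vector_mult_add_rdistrib scaleR_matrix_vector)
      then have "(ctranspose E ** Y) *v x + t *\<^sub>R x = 0"
        by (simp add: matrix_vector_right_distrib matrix_vector_scaleR matrix_vector_mul_assoc EE)
      then have "(ctranspose E ** Y) *v x = (- t) *\<^sub>R x"
        by (simp add: eq_neg_iff_add_eq_0)
      with \<open>x \<noteq> 0\<close> show "t \<in> uminus ` {r. \<exists>x. x \<noteq> 0 \<and> (ctranspose E ** Y) *v x = r *\<^sub>R x}"
        by (intro image_eqI[of _ _ "- t"]) auto
    qed
    then show ?thesis
      by (rule finite_subset[OF _ finite_imageI[OF finite_real_eigenvalues_linear[OF matrix_vector_mul_linear]]])
  qed
  ultimately show ?thesis
    by (rule null_sets_lborel_of_line_sections)
qed

section \<open>Orthogonal invariance of Lebesgue measure\<close>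

text \<open>
  The uniqueness of Haar measure in the form
  \<open>\<mu>(A) \<nu>(B) = \<nu>(-A) \<mu>(B)\<close>: integrate the indicator function of
  \<open>x \<in> A \<and> x + y \<in> B\<close> against both measures, and shift \<open>y\<close>
  by \<open>x\<close> in one order of integration and \<open>x\<close> by \<open>-y\<close> in the
  other.
\<close>

lemma translation_invariant_measures_cross:
  fixes \<mu> \<nu> :: "'a::euclidean_space measure"
  assumes [measurable_cong]: "sets \<mu> = sets borel" "sets \<nu> = sets borel"
    and "sigma_finite_measure \<mu>" "sigma_finite_measure \<nu>"
    and \<mu>: "\<And>c. distr \<mu> borel ((+) c) = \<mu>" and \<nu>: "\<And>c. distr \<nu> borel ((+) c) = \<nu>"
    and [measurable]: "A \<in> sets borel" "B \<in> sets borel"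
  shows "emeasure \<mu> A * emeasure \<nu> B = emeasure \<nu> (uminus -` A) * emeasure \<mu> B"
proof -
  interpret \<mu>: sigma_finite_measure \<mu> by fact
  interpret \<nu>: sigma_finite_measure \<nu> by fact
  interpret pair_sigma_finite \<mu> \<nu> ..
  have shift\<mu>: "(\<integral>\<^sup>+x. f (c + x) \<partial>\<mu>) = (\<integral>\<^sup>+x. f x \<partial>\<mu>)" if [measurable]: "f \<in> borel_measurable borel" for f c
    by (subst (2) \<mu>[symmetric, of c]) (simp add: nn_integral_distr)
  have shift\<nu>: "(\<integral>\<^sup>+x. f (c + x) \<partial>\<nu>) = (\<integral>\<^sup>+x. f x \<partial>\<nu>)" if [measurable]: "f \<in> borel_measurable borel" for f c
    by (subst (2) \<nu>[symmetric, of c]) (simp add: nn_integral_distr)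
  have [measurable]: "uminus -` A \<in> sets borel"
    using measurable_sets_borel[of "uminus :: 'a \<Rightarrow> 'a" borel A] by simp
  have "emeasure \<mu> A * emeasure \<nu> B = (\<integral>\<^sup>+x. indicator A x * (\<integral>\<^sup>+y. indicator B y \<partial>\<nu>) \<partial>\<mu>)"
    by (simp add: nn_integral_multc)
  also have "\<dots> = (\<integral>\<^sup>+x. indicator A x * (\<integral>\<^sup>+y. indicator B (x + y) \<partial>\<nu>) \<partial>\<mu>)"
    by (subst shift\<nu>) simp_all
  also have "\<dots> = (\<integral>\<^sup>+x. (\<integral>\<^sup>+y. indicator A x * indicator B (x + y) \<partial>\<nu>) \<partial>\<mu>)"
    by (simp add: nn_integral_cmult)
  also have "\<dots> = (\<integral>\<^sup>+y. (\<integral>\<^sup>+x. indicator A x * indicator B (x + y) \<partial>\<mu>) \<partial>\<nu>)"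
    by (rule Fubini'[symmetric]) simp
  also have "\<dots> = (\<integral>\<^sup>+y. (\<integral>\<^sup>+x. indicator A (- y + x) * indicator B x \<partial>\<mu>) \<partial>\<nu>)"
  proof (rule nn_integral_cong)
    fix y
    show "(\<integral>\<^sup>+x. indicator A x * indicator B (x + y) \<partial>\<mu>)
        = (\<integral>\<^sup>+x. indicator A (- y + x) * indicator B x \<partial>\<mu>)"
      using shift\<mu>[of "\<lambda>x. indicator A x * indicator B (x + y)" "- y"] by simp
  qed
  also have "\<dots> = (\<integral>\<^sup>+x. (\<integral>\<^sup>+y. indicator A (- y + x) * indicator B x \<partial>\<nu>) \<partial>\<mu>)"
    by (rule Fubini') simp
  also have "\<dots> = (\<integral>\<^sup>+x. (\<integral>\<^sup>+y. indicator (uminus -` A) (- x + y) \<partial>\<nu>) * indicator B x \<partial>\<mu>)"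
    by (simp add: nn_integral_multc indicator_def)
  also have "\<dots> = (\<integral>\<^sup>+x. emeasure \<nu> (uminus -` A) * indicator B x \<partial>\<mu>)"
    by (subst shift\<nu>) (simp_all add: nn_integral_indicator)
  also have "\<dots> = emeasure \<nu> (uminus -` A) * emeasure \<mu> B"
    by (simp add: nn_integral_cmult)
  finally show ?thesis .
qed

text \<open>
  The image measure is translation invariant as well, hence a multiple of Lebesgue measure; the
  unit ball is mapped to itself, so the factor is \<open>1\<close>.
\<close>

lemma distr_lborel_orthogonal_transformation:
  fixes K :: "'a::euclidean_space \<Rightarrow> 'a"
  assumes K: "orthogonal_transformation K"
  shows "distr lborel borel K = lborel"
proof (rule measure_eqI)
  note lin = orthogonal_transformation_linear[OF K]
  have [measurable]: "K \<in> borel_measurable borel"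
    by (intro borel_measurable_continuous_onI linear_continuous_on linear_linear[THEN iffD2] lin)
  obtain J where J: "\<And>x. K (J x) = x"
    using orthogonal_transformation_surj[OF K] by (metis surjD)
  have trans: "distr (distr lborel borel K) borel ((+) c) = distr lborel borel K" for c
  proof -
    have "distr (distr lborel borel K) borel ((+) c) = distr lborel borel (\<lambda>x. K (J c + x))"
      by (simp add: distr_distr comp_def linear_add[OF lin] J)
    also have "\<dots> = distr (distr lborel borel ((+) (J c))) borel K"
      by (simp add: distr_distr comp_def)
    finally show ?thesis
      by (simp add: lborel_distr_plus)
  qed
  have ball: "K -` ball 0 1 = ball 0 1"
    using orthogonal_transformation_norm[OF K] by auto
  have finite_ball: "emeasure (distr lborel borel K) (ball 0 1) = emeasure lborel (ball (0::'a) 1)"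
    by (simp add: emeasure_distr ball)
  show "sets (distr lborel borel K) = sets lborel" by simp
  fix B assume "B \<in> sets (distr lborel borel K)"
  then have [measurable]: "B \<in> sets borel" by simp
  have "sigma_finite_measure (distr lborel borel K)"
  proof (standard, intro exI conjI)
    let ?A = "range (\<lambda>n::nat. ball (0::'a) (real n))"
    show "countable ?A" "?A \<subseteq> sets (distr lborel borel K)" by auto
    show "\<Union>?A = space (distr lborel borel K)"
      using real_arch_simple by (auto simp: dist_norm) (metis reals_Archimedean2)
    show "\<forall>a\<in>?A. emeasure (distr lborel borel K) a \<noteq> \<infinity>"
    proof safe
      fix n :: nat
      assume *: "emeasure (distr lborel borel K) (ball 0 (real n)) = \<infinity>"
      have "K -` ball 0 (real n) = ball 0 (real n)"
        using orthogonal_transformation_norm[OF K] by auto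
      with * have "emeasure lborel (ball (0::'a) (real n)) = \<infinity>"
        by (simp add: emeasure_distr)
      then show False
        using emeasure_lborel_ball_finite[of 0 "real n"] by (metis infinity_ennreal_def less_irrefl)
    qed
  qed
  then have "emeasure (distr lborel borel K) (ball 0 1) * emeasure lborel B
      = emeasure lborel (uminus -` ball (0::'a) 1) * emeasure (distr lborel borel K) B"
    by (intro translation_invariant_measures_cross trans lborel_distr_plus) (auto intro: sigma_finite_lborel)
  moreover have "uminus -` ball (0::'a) 1 = ball 0 1"
    by auto
  ultimately have eq: "emeasure lborel (ball (0::'a) 1) * emeasure lborel B
      = emeasure lborel (ball (0::'a) 1) * emeasure (distr lborel borel K) B"
    by (simp add: finite_ball)
  have "emeasure lborel (ball (0::'a) 1) \<noteq> \<infinity>"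
    using emeasure_lborel_ball_finite[of "0::'a" 1] by (metis infinity_ennreal_def less_irrefl)
  moreover have "emeasure lborel (ball (0::'a) 1) \<noteq> 0"
    using open_not_negligible[of "ball (0::'a) 1"]
    by (auto simp: negligible_iff_null_sets null_sets_def)
  ultimately show "emeasure (distr lborel borel K) B = emeasure lborel B"
    using eq by (simp add: ennreal_mult_cancel_left)
qed

section \<open>Isotropic Gaussian measures\<close>

text \<open>
  The law of a vector whose coordinates are independent centred normal variables of standard
  deviation \<open>\<sigma>\<close>. Defining it as an image of a product measure, rather than by its density, makes
  projections onto coordinates accessible.
\<close>

definition gaussian :: "real \<Rightarrow> 'a::euclidean_space measure" where
  "gaussian \<sigma> = distr (\<Pi>\<^sub>M b\<in>Basis. density lborel (normal_density 0 \<sigma>)) borel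
     (\<lambda>f. \<Sum>b\<in>Basis. f b *\<^sub>R b)"

lemma sets_gaussian [simp, measurable_cong]: "sets (gaussian \<sigma>) = sets borel"
  by (simp add: gaussian_def)

lemma space_gaussian [simp]: "space (gaussian \<sigma>) = UNIV"
  by (simp add: gaussian_def)

lemma measurable_sum_basis [measurable]:
  assumes "\<And>b. sets (M b) = sets borel"
  shows "(\<lambda>f. \<Sum>b\<in>Basis. f b *\<^sub>R b) \<in> borel_measurable (\<Pi>\<^sub>M b\<in>(Basis::'a::euclidean_space set). M b)"
proof (intro borel_measurable_sum borel_measurable_scaleR)
  fix b :: 'a assume "b \<in> Basis"
  then have "(\<lambda>f. f b) \<in> measurable (\<Pi>\<^sub>M b\<in>Basis. M b) (M b)"
    by (rule measurable_component_singleton)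
  then show "(\<lambda>f. f b) \<in> borel_measurable (\<Pi>\<^sub>M b\<in>Basis. M b)"
    by (simp add: measurable_cong_sets[OF refl assms])
qed auto

lemma prob_space_gaussian: "0 < \<sigma> \<Longrightarrow> prob_space (gaussian \<sigma>)"
  unfolding gaussian_def
  by (rule prob_space.prob_space_distr[OF prob_space_PiM[OF prob_space_normal_density]
        measurable_sum_basis]) simp_all

lemma density_PiM:
  fixes g :: "'i \<Rightarrow> 'b \<Rightarrow> ennreal"
  assumes I: "finite I"
    and M: "\<And>i. sigma_finite_measure (M i)"
    and D: "\<And>i. sigma_finite_measure (density (M i) (g i))"
    and [measurable]: "\<And>i. g i \<in> borel_measurable (M i)"
  shows "(\<Pi>\<^sub>M i\<in>I. density (M i) (g i)) = density (\<Pi>\<^sub>M i\<in>I. M i) (\<lambda>x. \<Prod>i\<in>I. g i (x i))"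
proof -
  interpret M: product_sigma_finite M
    by (intro product_sigma_finite.intro M)
  interpret D: product_sigma_finite "\<lambda>i. density (M i) (g i)"
    by (intro product_sigma_finite.intro D)
  show ?thesis
  proof (rule D.PiM_eqI[symmetric, OF I])
    show "sets (density (Pi\<^sub>M I M) (\<lambda>x. \<Prod>i\<in>I. g i (x i))) = sets (\<Pi>\<^sub>M i\<in>I. density (M i) (g i))"
      by (simp cong: sets_PiM_cong)
    fix A assume "\<And>i. i \<in> I \<Longrightarrow> A i \<in> sets (density (M i) (g i))"
    then have A [measurable]: "\<And>i. i \<in> I \<Longrightarrow> A i \<in> sets (M i)" by simp
    have [measurable]: "Pi\<^sub>E I A \<in> sets (Pi\<^sub>M I M)"
      by (rule sets_PiM_I_finite[OF I A])
    have "emeasure (density (Pi\<^sub>M I M) (\<lambda>x. \<Prod>i\<in>I. g i (x i))) (Pi\<^sub>E I A)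
        = (\<integral>\<^sup>+x. (\<Prod>i\<in>I. g i (x i)) * indicator (Pi\<^sub>E I A) x \<partial>Pi\<^sub>M I M)"
      by (subst emeasure_density) auto
    also have "\<dots> = (\<integral>\<^sup>+x. (\<Prod>i\<in>I. g i (x i) * indicator (A i) (x i)) \<partial>Pi\<^sub>M I M)"
    proof (rule nn_integral_cong)
      fix x assume "x \<in> space (Pi\<^sub>M I M)"
      then have "indicator (Pi\<^sub>E I A) x = (\<Prod>i\<in>I. indicator (A i) (x i) :: ennreal)"
        using I by (auto simp: space_PiM indicator_def PiE_iff)
      then show "(\<Prod>i\<in>I. g i (x i)) * indicator (Pi\<^sub>E I A) x
          = (\<Prod>i\<in>I. g i (x i) * indicator (A i) (x i))"
        by (simp add: prod.distrib)
    qed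
    also have "\<dots> = (\<Prod>i\<in>I. \<integral>\<^sup>+x. g i x * indicator (A i) x \<partial>M i)"
      by (rule M.product_nn_integral_prod[OF I]) auto
    also have "\<dots> = (\<Prod>i\<in>I. emeasure (density (M i) (g i)) (A i))"
      by (intro prod.cong refl) (simp add: emeasure_density)
    finally show "emeasure (density (Pi\<^sub>M I M) (\<lambda>x. \<Prod>i\<in>I. g i (x i))) (Pi\<^sub>E I A)
        = (\<Prod>i\<in>I. emeasure (density (M i) (g i)) (A i))" .
  qed
qed

text \<open>
  The product of the coordinate densities depends on the norm only. With this form of the density,
  rotation invariance is inherited from Lebesgue measure.
\<close>

lemma gaussian_density:
  fixes \<sigma> :: real
  assumes \<sigma>: "0 < \<sigma>"
  shows "(gaussian \<sigma> :: 'a::euclidean_space measure) = density lborel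
    (\<lambda>x. ennreal ((2 * pi * \<sigma>\<^sup>2) powr (- (real DIM('a) / 2)) * exp (- (norm x)\<^sup>2 / (2 * \<sigma>\<^sup>2))))"
proof -
  let ?h = "\<lambda>x::'a. \<Prod>b\<in>Basis. ennreal (normal_density 0 \<sigma> (x \<bullet> b))"
  let ?e = "\<lambda>f. \<Sum>b\<in>(Basis::'a set). f b *\<^sub>R b"
  have "(gaussian \<sigma> :: 'a measure) = distr (density (\<Pi>\<^sub>M b\<in>Basis. lborel)
      (\<lambda>f. \<Prod>b\<in>Basis. ennreal (normal_density 0 \<sigma> (f b)))) borel ?e"
    unfolding gaussian_def
    using prob_space_normal_density[OF \<sigma>] sigma_finite_lborel
    by (subst density_PiM) (auto intro: prob_space_imp_sigma_finite)
  also have "\<dots> = distr (density (\<Pi>\<^sub>M b\<in>Basis. lborel) (\<lambda>f. ?h (?e f))) borel ?e"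
  proof -
    have "(\<lambda>f. \<Prod>b\<in>Basis. ennreal (normal_density 0 \<sigma> (f b))) = (\<lambda>f. ?h (?e f))"
      by (simp add: fun_eq_iff inner_sum_left_Basis cong: prod.cong)
    then show ?thesis by simp
  qed
  also have "\<dots> = density (distr (\<Pi>\<^sub>M b\<in>Basis. lborel) borel ?e) ?h"
    by (rule density_distr[symmetric]) auto
  also have "\<dots> = density lborel ?h"
    by (simp add: lborel_eq[symmetric])
  also have "?h = (\<lambda>x. ennreal ((2 * pi * \<sigma>\<^sup>2) powr (- (real DIM('a) / 2)) * exp (- (norm x)\<^sup>2 / (2 * \<sigma>\<^sup>2))))"
  proof
    fix x :: 'a
    have pos: "0 < 2 * pi * \<sigma>\<^sup>2" using \<sigma> by simp
    have "?h x = ennreal (\<Prod>b\<in>Basis. normal_density 0 \<sigma> (x \<bullet> b))"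
      by (simp add: prod_ennreal)
    also have "(\<Prod>b\<in>Basis. normal_density 0 \<sigma> (x \<bullet> b))
        = (1 / sqrt (2 * pi * \<sigma>\<^sup>2)) ^ DIM('a) * (\<Prod>b\<in>Basis. exp (- (x \<bullet> b)\<^sup>2 / (2 * \<sigma>\<^sup>2)))"
      unfolding normal_density_def by (simp only: prod.distrib prod_constant diff_zero)
    also have "(\<Prod>b\<in>Basis. exp (- (x \<bullet> b)\<^sup>2 / (2 * \<sigma>\<^sup>2))) = exp (\<Sum>b\<in>Basis. - (x \<bullet> b)\<^sup>2 / (2 * \<sigma>\<^sup>2))"
      by (simp add: exp_sum)
    also have "(\<Sum>b\<in>Basis. - (x \<bullet> b)\<^sup>2 / (2 * \<sigma>\<^sup>2)) = - (norm x)\<^sup>2 / (2 * \<sigma>\<^sup>2)"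
      unfolding power2_norm_eq_inner euclidean_inner[of x x]
      by (simp add: sum_negf sum_divide_distrib power2_eq_square)
    also have "(1 / sqrt (2 * pi * \<sigma>\<^sup>2)) ^ DIM('a) = (2 * pi * \<sigma>\<^sup>2) powr (- (real DIM('a) / 2))"
    proof -
      have "1 / sqrt (2 * pi * \<sigma>\<^sup>2) = (2 * pi * \<sigma>\<^sup>2) powr (- (1/2))"
        using pos by (simp only: powr_minus_divide powr_half_sqrt)
      then show ?thesis
        using pos powr_realpow[of "(2 * pi * \<sigma>\<^sup>2) powr (- (1/2))" "DIM('a)"]
        using \<sigma> by (simp add: powr_powr)
    qed
    finally show "?h x = ennreal ((2 * pi * \<sigma>\<^sup>2) powr (- (real DIM('a) / 2)) * exp (- (norm x)\<^sup>2 / (2 * \<sigma>\<^sup>2)))" .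
  qed
  finally show ?thesis .
qed

lemma distr_gaussian_orthogonal_transformation:
  fixes K :: "'a::euclidean_space \<Rightarrow> 'a"
  assumes \<sigma>: "0 < \<sigma>" and K: "orthogonal_transformation K"
  shows "distr (gaussian \<sigma>) borel K = gaussian \<sigma>"
proof -
  let ?h = "\<lambda>x::'a. ennreal ((2 * pi * \<sigma>\<^sup>2) powr (- (real DIM('a) / 2)) * exp (- (norm x)\<^sup>2 / (2 * \<sigma>\<^sup>2)))"
  note lin = orthogonal_transformation_linear[OF K]
  have [measurable]: "K \<in> borel_measurable borel"
    by (intro borel_measurable_continuous_onI linear_continuous_on linear_linear[THEN iffD2] lin)
  have "distr (gaussian \<sigma>) borel K = distr (density lborel (\<lambda>x. ?h (K x))) borel K"
    by (simp add: gaussian_density[OF \<sigma>] orthogonal_transformation_norm[OF K])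
  also have "\<dots> = density (distr lborel borel K) ?h"
    by (rule density_distr[symmetric]) auto
  finally show ?thesis
    by (simp add: distr_lborel_orthogonal_transformation[OF K] gaussian_density[OF \<sigma>])
qed

text \<open>
  Coordinates of a Gaussian vector are independent, and a subfamily of them has a product law.
\<close>

lemma distr_gaussian_coordinates:
  fixes \<iota> :: "'b::euclidean_space \<Rightarrow> 'a::euclidean_space"
  assumes \<sigma>: "0 < \<sigma>" and inj: "inj_on \<iota> Basis" and sub: "\<iota> ` Basis \<subseteq> Basis"
  shows "distr (gaussian \<sigma>) borel (\<lambda>x. \<Sum>c\<in>Basis. (x \<bullet> \<iota> c) *\<^sub>R c) = gaussian \<sigma>"
proof -
  let ?N = "density lborel (normal_density 0 \<sigma>) :: real measure"
  let ?P = "\<Pi>\<^sub>M b\<in>(Basis :: 'a set). ?N" and ?Q = "\<Pi>\<^sub>M c\<in>(Basis :: 'b set). ?N"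
  let ?r = "\<lambda>f. \<lambda>c\<in>(Basis::'b set). f (\<iota> c)"
  have \<iota>: "\<iota> \<in> Basis \<rightarrow> Basis" using sub by auto
  have m [measurable]: "?r \<in> measurable ?P ?Q"
    using \<iota> by (intro measurable_restrict measurable_component_singleton) auto
  have e [measurable]: "(\<lambda>f. \<Sum>b\<in>Basis. f b *\<^sub>R b) \<in> borel_measurable ?P"
     "(\<lambda>f. \<Sum>b\<in>Basis. f b *\<^sub>R b) \<in> borel_measurable ?Q"
    by (rule measurable_sum_basis, simp)+
  have "distr (gaussian \<sigma>) borel (\<lambda>x. \<Sum>c\<in>Basis. (x \<bullet> \<iota> c) *\<^sub>R c) =
      distr ?P borel (\<lambda>f. \<Sum>c\<in>(Basis::'b set). ((\<Sum>b\<in>Basis. f b *\<^sub>R b) \<bullet> \<iota> c) *\<^sub>R c)"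
    unfolding gaussian_def by (subst distr_distr) (auto simp: comp_def)
  also have "\<dots> = distr ?P borel ((\<lambda>f. \<Sum>b\<in>Basis. f b *\<^sub>R b) \<circ> ?r)"
    using sub by (intro arg_cong[of _ _ "distr ?P borel"]) (auto simp: fun_eq_iff inner_sum_left_Basis intro!: sum.cong)
  also have "\<dots> = distr (distr ?P ?Q ?r) borel (\<lambda>f. \<Sum>b\<in>Basis. f b *\<^sub>R b)"
    by (rule distr_distr[symmetric]) auto
  also have "distr ?P ?Q ?r = ?Q"
    by (rule distr_PiM_reindex[OF prob_space_normal_density[OF \<sigma>] inj \<iota>])
  finally show ?thesis
    by (simp add: gaussian_def)
qed

text \<open>
  The images of the basis vectors under an isometry \<open>T\<close> extend to an orthonormal
  basis, and an orthogonal transformation takes this basis to the standard one.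
\<close>

lemma orthonormal_frame_to_basis:
  fixes T :: "'b::euclidean_space \<Rightarrow> 'a::euclidean_space"
  assumes iT: "\<And>x y. T x \<bullet> T y = x \<bullet> y"
  obtains \<pi> :: "'a \<Rightarrow> 'a" and \<iota> :: "'b \<Rightarrow> 'a"
    where "orthogonal_transformation \<pi>" "inj_on \<iota> Basis" "\<iota> ` Basis \<subseteq> Basis"
      "\<And>c. c \<in> Basis \<Longrightarrow> \<pi> (T c) = \<iota> c"
proof -
  have injT: "inj_on T Basis"
    by (rule inj_onI) (metis iT inner_same_Basis inner_not_same_Basis zero_neq_one)
  have normT: "norm (T c) = 1" if "c \<in> Basis" for c
    using that by (simp add: norm_eq_sqrt_inner[of "T c"] iT)
  have orthT: "pairwise orthogonal (T ` Basis)"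
    by (auto simp: pairwise_def orthogonal_def iT inner_Basis)
  obtain U where U: "pairwise orthogonal (T ` Basis \<union> U)"
      "U \<inter> insert 0 (T ` Basis) = {}" "span (T ` Basis \<union> U) = span (T ` Basis \<union> UNIV)"
    using orthogonal_extension_strong[OF orthT] by metis
  define B where "B = (\<lambda>u. u /\<^sub>R norm u) ` (T ` Basis \<union> U)"
  have nz: "norm u \<noteq> 0" if "u \<in> T ` Basis \<union> U" for u
    using that U(2) normT by force
  have normB: "norm b = 1" if "b \<in> B" for b
    using that nz unfolding B_def by force
  have orthB: "pairwise orthogonal B"
  proof -
    have "pairwise orthogonal ((\<lambda>u. u /\<^sub>R norm u) ` V)" if "pairwise orthogonal V" for V :: "'a set"
      using that by (auto simp: pairwise_def orthogonal_def)
    then show ?thesis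
      using U(1) unfolding B_def by blast
  qed
  have "independent B"
    using normB by (intro pairwise_orthogonal_independent[OF orthB]) force
  then have finB: "finite B"
    by (rule independent_imp_finite)
  have "span B = UNIV"
  proof -
    have "T ` Basis \<union> U \<subseteq> span B"
    proof
      fix u assume u: "u \<in> T ` Basis \<union> U"
      have "norm u *\<^sub>R (u /\<^sub>R norm u) \<in> span B"
        using u by (intro span_scale span_base) (auto simp: B_def)
      then show "u \<in> span B"
        using nz[OF u] by simp
    qed
    then show ?thesis
      using U(3) by (metis Un_UNIV_right span_UNIV span_minimal subspace_span top.extremum_uniqueI)
  qed
  then have expand: "x = (\<Sum>b\<in>B. (x \<bullet> b) *\<^sub>R b)" for x
    using orthonormal_basis_expand[OF orthB normB _ finB, of x] by simp
  have "card B = DIM('a)"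
    using \<open>independent B\<close> \<open>span B = UNIV\<close> by (metis dim_UNIV dim_eq_card_independent dim_span)
  then obtain h where h: "bij_betw h B (Basis :: 'a set)"
    using finite_same_card_bij[OF finB finite_Basis] by auto
  \<comment> \<open>The injection into the standard basis is read off from the extended basis instead of being prescribed.\<close>
  define \<iota> where "\<iota> c = h (T c)" for c
  have TB: "T c \<in> B" if "c \<in> Basis" for c
  proof -
    have "T c = T c /\<^sub>R norm (T c)"
      by (simp add: normT[OF that])
    then show ?thesis
      using that unfolding B_def by blast
  qed
  have \<iota>: "inj_on \<iota> Basis" "\<iota> ` Basis \<subseteq> Basis"
    using h TB injT unfolding \<iota>_def bij_betw_def inj_on_def by blast+
  define \<pi> where "\<pi> x = (\<Sum>b\<in>B. (x \<bullet> b) *\<^sub>R h b)" for x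
  have "linear \<pi>"
    unfolding \<pi>_def by (intro linear_compose_sum ballI linearI) (auto simp: inner_add_left algebra_simps)
  moreover have "norm (\<pi> x) = norm x" for x
  proof -
    have "pairwise (\<lambda>a b. orthogonal (h a) (h b)) B"
      using h unfolding pairwise_def bij_betw_def inj_on_def orthogonal_def
      by (metis image_eqI inner_not_same_Basis)
    then have "(norm (\<pi> x))\<^sup>2 = (\<Sum>b\<in>B. (norm ((x \<bullet> b) *\<^sub>R h b))\<^sup>2)"
      unfolding \<pi>_def by (intro norm_sum_Pythagorean[OF finB] pairwise_ortho_scaleR)
    also have "\<dots> = (\<Sum>b\<in>B. (norm ((x \<bullet> b) *\<^sub>R b))\<^sup>2)"
      using bij_betwE[OF h] by (intro sum.cong refl) (simp add: normB)
    also have "\<dots> = (norm (\<Sum>b\<in>B. (x \<bullet> b) *\<^sub>R b))\<^sup>2"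
      using orthB by (intro norm_sum_Pythagorean[OF finB, symmetric] pairwise_ortho_scaleR)
    finally show ?thesis
      by (simp flip: expand)
  qed
  ultimately have K: "orthogonal_transformation \<pi>"
    by (simp add: orthogonal_transformation)
  have \<pi>T: "\<pi> (T c) = \<iota> c" if "c \<in> Basis" for c
  proof -
    have "\<pi> (T c) = (\<Sum>b\<in>B. if b = T c then h b else 0)"
      unfolding \<pi>_def using TB[OF that] orthB normB
      by (intro sum.cong refl) (auto simp: pairwise_def orthogonal_def dot_square_norm inner_commute)
    then show ?thesis
      using finB TB[OF that] by (simp add: \<iota>_def)
  qed
  show ?thesis
    by (rule that[OF K \<iota> \<pi>T])
qed

text \<open>
  The conditions say that \<open>T\<close> is the adjoint of \<open>L\<close> and that
  \<open>L T = 1\<close>. Up to an orthogonal transformation, such a map is the projection onto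
  some of the coordinates.
\<close>

lemma distr_gaussian_coisometry:
  fixes L :: "'a::euclidean_space \<Rightarrow> 'b::euclidean_space"
  assumes \<sigma>: "0 < \<sigma>"
    and adj: "\<And>x y. L x \<bullet> y = x \<bullet> T y" and LT: "\<And>y. L (T y) = y"
  shows "distr (gaussian \<sigma>) borel L = gaussian \<sigma>"
proof -
  have "T x \<bullet> T y = x \<bullet> y" for x y
    by (metis LT adj)
  then obtain \<pi> :: "'a \<Rightarrow> 'a" and \<iota> :: "'b \<Rightarrow> 'a"
    where K: "orthogonal_transformation \<pi>" and \<iota>: "inj_on \<iota> Basis" "\<iota> ` Basis \<subseteq> Basis"
      and \<pi>T: "\<And>c. c \<in> Basis \<Longrightarrow> \<pi> (T c) = \<iota> c"
    by (rule orthonormal_frame_to_basis) blast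
  have "L = (\<lambda>x. \<Sum>c\<in>Basis. (x \<bullet> \<iota> c) *\<^sub>R c) \<circ> \<pi>"
  proof
    fix x
    have "L x = (\<Sum>c\<in>Basis. (L x \<bullet> c) *\<^sub>R c)"
      by (simp add: euclidean_representation)
    also have "\<dots> = (\<Sum>c\<in>Basis. (\<pi> x \<bullet> \<pi> (T c)) *\<^sub>R c)"
      using K by (simp add: adj orthogonal_transformation_def)
    also have "\<dots> = (\<Sum>c\<in>Basis. (\<pi> x \<bullet> \<iota> c) *\<^sub>R c)"
      by (intro sum.cong refl) (simp add: \<pi>T)
    finally show "L x = ((\<lambda>x. \<Sum>c\<in>Basis. (x \<bullet> \<iota> c) *\<^sub>R c) \<circ> \<pi>) x" by simp
  qed
  moreover have [measurable]: "\<pi> \<in> borel_measurable borel"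
    by (intro borel_measurable_continuous_onI linear_continuous_on linear_linear[THEN iffD2]
        orthogonal_transformation_linear K)
  ultimately have "distr (gaussian \<sigma>) borel L
      = distr (distr (gaussian \<sigma>) borel \<pi>) borel (\<lambda>x. \<Sum>c\<in>Basis. (x \<bullet> \<iota> c) *\<^sub>R c)"
    by (simp add: distr_distr)
  then show ?thesis
    by (simp add: distr_gaussian_orthogonal_transformation[OF \<sigma> K] distr_gaussian_coordinates[OF \<sigma> \<iota>])
qed

section \<open>Gaussian and Wishart matrices\<close>

lemma eigenvalue_prod_mat_one: "eigenvalue_prod (mat 1 :: 'a::hermitian_scalar^'m^'m) = 1"
proof -
  have "r = 1" if r: "right_eigenvalue (mat 1 :: 'a^'m^'m) (of_real r)" for r
  proof -
    obtain x :: "'a^'m" where "x \<noteq> 0" "r *\<^sub>R x = x"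
      using r unfolding right_eigenvalue_of_real matrix_vector_mul_lid by metis
    then have "(1 - r) *\<^sub>R x = 0"
      by (simp add: scaleR_left_diff_distrib)
    with \<open>x \<noteq> 0\<close> show ?thesis by simp
  qed
  then show ?thesis
    unfolding eigenvalue_prod_def by (intro prod.neutral ballI) (metis mem_Collect_eq power_one)
qed

text \<open>
  As \<open>\<beta>\<close> is the real dimension of the scalars, the normalizing power of
  \<open>2 \<pi> / \<beta>\<close> is that of independent real entries of variance
  \<open>1 / \<beta>\<close>.
\<close>

lemma matrix_normal_mat_one:
  "(matrix_normal (mat 1) :: ('a::hermitian_scalar^'n^'m) measure) = gaussian (1 / sqrt (real DIM('a)))"
proof -
  have "matrix_inv (mat 1 :: 'a^'m^'m) = mat 1"
    by (rule matrix_inv_eqI) simp_all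
  then have "matrix_normal_density (mat 1) X =
      (2 * pi / real DIM('a)) powr - (real DIM('a^'n^'m) / 2) * exp (- (norm X)\<^sup>2 / (2 / real DIM('a)))"
    for X :: "'a^'n^'m"
    by (simp add: matrix_normal_density_def eigenvalue_prod_mat_one real_part_trace_gram mult.assoc)
  then show ?thesis
    unfolding matrix_normal_def
    by (subst gaussian_density) (simp_all add: power_divide)
qed

lemma borel_measurable_matrix_mult [measurable (raw)]:
  fixes f :: "'b \<Rightarrow> 'a::hermitian_scalar^'n^'m"
  assumes "f \<in> borel_measurable M" "g \<in> borel_measurable M"
  shows "(\<lambda>x. f x ** g x) \<in> borel_measurable M"
  by (rule borel_measurable_continuous_Pair[OF assms]) (intro continuous_intros)

lemma borel_measurable_ctranspose [measurable]:
  "(ctranspose :: 'a::hermitian_scalar^'n^'m \<Rightarrow> _) \<in> borel_measurable borel"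
  by (intro borel_measurable_continuous_onI continuous_intros)

lemma distr_gaussian_ctranspose:
  assumes "0 < \<sigma>"
  shows "distr (gaussian \<sigma>) borel (ctranspose :: 'a::hermitian_scalar^'n^'m \<Rightarrow> _) = gaussian \<sigma>"
  by (rule distr_gaussian_coisometry[OF assms, where T = ctranspose]) (simp_all add: inner_ctranspose)

lemma distr_gaussian_coisometric_matrix:
  fixes H :: "'a::hermitian_scalar^'m^'p"
  assumes "0 < \<sigma>" and H: "ctranspose H ** H = mat 1"
  shows "distr (gaussian \<sigma>) borel (\<lambda>X :: 'a^'n^'p. ctranspose H ** X) = gaussian \<sigma>"
  by (rule distr_gaussian_coisometry[OF assms(1), where T = "\<lambda>Z. H ** Z"])
     (simp_all add: inner_matrix_mult_left matrix_mul_assoc H)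

text \<open>
  Independence in the form of conditioning: with \<open>b y\<close> held fixed, only the law of
  the first argument matters. The laws are represented through auxiliary spaces \<open>P\<close>
  and \<open>Q\<close>, which will carry the Gaussian matrices behind the Wishart matrices.
\<close>

lemma emeasure_distr_indep_pair:
  assumes "prob_space M" "prob_space.indep_var M borel A borel B"
    and A: "distr M borel A = distr P borel a" and B: "distr M borel B = distr Q borel b"
    and "prob_space P" "prob_space Q"
    and [measurable]: "a \<in> borel_measurable P" "b \<in> borel_measurable Q"
    and [measurable]: "(\<lambda>p. f (fst p) (snd p)) \<in> borel_measurable (borel \<Otimes>\<^sub>M borel)"
    and [measurable]: "T \<in> sets borel"
  shows "emeasure (distr M borel (\<lambda>\<omega>. f (A \<omega>) (B \<omega>))) T
    = (\<integral>\<^sup>+y. emeasure (distr P borel (\<lambda>x. f (a x) (b y))) T \<partial>Q)"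
proof -
  interpret M: prob_space M by fact
  interpret P: prob_space P by fact
  interpret Q: prob_space Q by fact
  interpret PQ: pair_prob_space P Q ..
  have AB: "distr M borel A \<Otimes>\<^sub>M distr M borel B = distr M (borel \<Otimes>\<^sub>M borel) (\<lambda>\<omega>. (A \<omega>, B \<omega>))"
    and [measurable]: "A \<in> borel_measurable M" "B \<in> borel_measurable M"
    using iffD1[OF M.indep_var_distribution_eq assms(2)] by blast+
  have "distr M borel (\<lambda>\<omega>. f (A \<omega>) (B \<omega>))
      = distr (distr M (borel \<Otimes>\<^sub>M borel) (\<lambda>\<omega>. (A \<omega>, B \<omega>))) borel (\<lambda>p. f (fst p) (snd p))"
    by (simp add: distr_distr comp_def)
  also have "distr M (borel \<Otimes>\<^sub>M borel) (\<lambda>\<omega>. (A \<omega>, B \<omega>)) = distr P borel a \<Otimes>\<^sub>M distr Q borel b"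
    by (simp add: AB[symmetric] A B)
  also have "\<dots> = distr (P \<Otimes>\<^sub>M Q) (borel \<Otimes>\<^sub>M borel) (\<lambda>(x, y). (a x, b y))"
    by (intro pair_measure_distr prob_space_imp_sigma_finite Q.prob_space_distr) simp_all
  also have "distr \<dots> borel (\<lambda>p. f (fst p) (snd p)) = distr (P \<Otimes>\<^sub>M Q) borel (\<lambda>(x, y). f (a x) (b y))"
    by (simp add: distr_distr comp_def split_beta')
  finally have eq: "distr M borel (\<lambda>\<omega>. f (A \<omega>) (B \<omega>)) = distr (P \<Otimes>\<^sub>M Q) borel (\<lambda>(x, y). f (a x) (b y))" .
  have m: "(\<lambda>(x, y). f (a x) (b y)) \<in> borel_measurable (P \<Otimes>\<^sub>M Q)"
  proof -
    have "(\<lambda>z. (\<lambda>p. f (fst p) (snd p)) (a (fst z), b (snd z))) \<in> borel_measurable (P \<Otimes>\<^sub>M Q)"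
      by measurable
    then show ?thesis
      by (simp add: split_beta')
  qed
  have "emeasure (distr (P \<Otimes>\<^sub>M Q) borel (\<lambda>(x, y). f (a x) (b y))) T
      = (\<integral>\<^sup>+y. emeasure P ((\<lambda>x. (x, y)) -` ((\<lambda>(x, y). f (a x) (b y)) -` T \<inter> space (P \<Otimes>\<^sub>M Q))) \<partial>Q)"
    using m by (simp add: emeasure_distr PQ.emeasure_pair_measure_alt2 measurable_sets)
  also have "\<dots> = (\<integral>\<^sup>+y. emeasure (distr P borel (\<lambda>x. f (a x) (b y))) T \<partial>Q)"
  proof (rule nn_integral_cong)
    fix y assume y: "y \<in> space Q"
    have "(\<lambda>x. f (a x) (b y)) \<in> borel_measurable P"
      using measurable_Pair_compose_split[OF m measurable_ident_sets[OF refl] measurable_const[OF y]] by simp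
    moreover have "(\<lambda>x. (x, y)) -` ((\<lambda>(x, y). f (a x) (b y)) -` T \<inter> space (P \<Otimes>\<^sub>M Q))
        = (\<lambda>x. f (a x) (b y)) -` T \<inter> space P"
      using y by (auto simp: space_pair_measure)
    ultimately show "emeasure P ((\<lambda>x. (x, y)) -` ((\<lambda>(x, y). f (a x) (b y)) -` T \<inter> space (P \<Otimes>\<^sub>M Q)))
        = emeasure (distr P borel (\<lambda>x. f (a x) (b y))) T"
      by (simp add: emeasure_distr)
  qed
  finally show ?thesis
    by (simp add: eq)
qed

lemma AE_gaussian_injective:
  assumes "0 < \<sigma>" "CARD('m) \<le> CARD('p)"
  shows "AE Y in gaussian \<sigma>. inj ((*v) (Y :: 'a::hermitian_scalar^'m^'p))"
  unfolding gaussian_density[OF assms(1)]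
  by (subst AE_density) (auto intro!: AE_I'[OF null_sets_lborel_not_injective[OF assms(2)]])

text \<open>
  Both laws are integrals over the Gaussian matrix \<open>Y\<close> of a law that depends on a
  second Gaussian matrix, which is \<open>X\<close> on one side and \<open>Z\<close> on the other.
  For each injective \<open>Y\<close> the integrands agree because \<open>H* X\<close> has the law
  of \<open>Z\<close>.
\<close>

lemma largest_eigenvalue_duality:
  fixes M :: "'s measure" and N :: "'t measure"
    and A B :: "'s \<Rightarrow> 'a::hermitian_scalar^'p^'p" and U W :: "'t \<Rightarrow> 'a^'m^'m"
  assumes M: "prob_space M" and N: "prob_space N"
    and nm: "CARD('n::finite) < CARD('m)" and mp: "CARD('m) < CARD('p)"
    and AB: "prob_space.indep_var M borel A borel B"
    and A: "distr M borel A = wishart TYPE('n) (mat 1)" and B: "distr M borel B = wishart TYPE('m) (mat 1)"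
    and UW: "prob_space.indep_var N borel U borel W"
    and U: "distr N borel U = wishart TYPE('n) (mat 1)" and W: "distr N borel W = wishart TYPE('p) (mat 1)"
  shows "same_distribution
    M (\<lambda>\<omega>. largest_eigenvalue (A \<omega> ** moore_penrose_inv (B \<omega>)))
    N (\<lambda>\<omega>. largest_eigenvalue (U \<omega> ** matrix_inv (W \<omega>)))"
proof -
  define \<sigma> where "\<sigma> = 1 / sqrt (real DIM('a))"
  have \<sigma>: "0 < \<sigma>" by (simp add: \<sigma>_def)
  note wish = wishart_def matrix_normal_mat_one \<sigma>_def[symmetric]
  let ?X = "gaussian \<sigma> :: ('a^'n^'p) measure" and ?Y = "gaussian \<sigma> :: ('a^'m^'p) measure"
    and ?Z = "gaussian \<sigma> :: ('a^'n^'m) measure"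
  let ?\<phi> = "\<lambda>a b :: 'a^'p^'p. largest_eigenvalue (a ** moore_penrose_inv b)"
  let ?\<psi> = "\<lambda>u w :: 'a^'m^'m. largest_eigenvalue (u ** matrix_inv w)"
  note [measurable] = borel_measurable_moore_penrose_inv borel_measurable_matrix_inv
    borel_measurable_largest_eigenvalue
  have [measurable]: "A \<in> borel_measurable M" "B \<in> borel_measurable M"
    "U \<in> borel_measurable N" "W \<in> borel_measurable N"
    using iffD1[OF prob_space.indep_var_distribution_eq[OF M] AB]
      iffD1[OF prob_space.indep_var_distribution_eq[OF N] UW] by blast+
  have meas: "(\<lambda>p. ?\<phi> (fst p) (snd p)) \<in> borel_measurable (borel \<Otimes>\<^sub>M borel)"
      "(\<lambda>p. ?\<psi> (fst p) (snd p)) \<in> borel_measurable (borel \<Otimes>\<^sub>M borel)"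
    by measurable
  \<comment> \<open>The \<open>m \<times> p\<close> Gaussian matrix behind \<open>W\<close> is replaced by the adjoint of a \<open>p \<times> m\<close> one.\<close>
  have W': "distr N borel W = distr ?Y borel (\<lambda>Y. ctranspose Y ** Y)"
    unfolding W wish
    by (subst distr_gaussian_ctranspose[OF \<sigma>, symmetric]) (simp add: distr_distr comp_def)
  have "distr M borel (\<lambda>\<omega>. ?\<phi> (A \<omega>) (B \<omega>)) = distr N borel (\<lambda>\<omega>. ?\<psi> (U \<omega>) (W \<omega>))"
  proof (rule measure_eqI)
    fix T assume "T \<in> sets (distr M borel (\<lambda>\<omega>. ?\<phi> (A \<omega>) (B \<omega>)))"
    then have T: "T \<in> sets borel" by simp
    have "emeasure (distr M borel (\<lambda>\<omega>. ?\<phi> (A \<omega>) (B \<omega>))) T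
        = (\<integral>\<^sup>+Y. emeasure (distr ?X borel (\<lambda>X. ?\<phi> (X ** ctranspose X) (Y ** ctranspose Y))) T \<partial>?Y)"
      by (rule emeasure_distr_indep_pair[OF M AB A[unfolded wish] B[unfolded wish]
            prob_space_gaussian[OF \<sigma>] prob_space_gaussian[OF \<sigma>] _ _ meas(1) T]) simp_all
    also have "\<dots> = (\<integral>\<^sup>+Y. emeasure (distr ?Z borel (\<lambda>Z. ?\<psi> (Z ** ctranspose Z) (ctranspose Y ** Y))) T \<partial>?Y)"
    proof (rule nn_integral_cong_AE)
      have "AE Y in ?Y. inj ((*v) Y)"
        using mp by (intro AE_gaussian_injective[OF \<sigma>]) simp
      then show "AE Y in ?Y. emeasure (distr ?X borel (\<lambda>X. ?\<phi> (X ** ctranspose X) (Y ** ctranspose Y))) T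
          = emeasure (distr ?Z borel (\<lambda>Z. ?\<psi> (Z ** ctranspose Z) (ctranspose Y ** Y))) T"
      proof (rule AE_mp, intro AE_I2 impI)
        fix Y :: "'a^'m^'p" assume "inj ((*v) Y)"
        then obtain H :: "'a^'m^'p" where H: "ctranspose H ** H = mat 1"
          and red: "\<And>X :: 'a^'n^'p. ?\<phi> (X ** ctranspose X) (Y ** ctranspose Y)
              = ?\<psi> ((ctranspose H ** X) ** ctranspose (ctranspose H ** X)) (ctranspose Y ** Y)"
          using largest_eigenvalue_reduction[OF _ nm mp] by blast
        have "distr ?X borel (\<lambda>X. ?\<phi> (X ** ctranspose X) (Y ** ctranspose Y))
            = distr (distr ?X borel (\<lambda>X. ctranspose H ** X)) borel (\<lambda>Z. ?\<psi> (Z ** ctranspose Z) (ctranspose Y ** Y))"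
          by (simp add: red distr_distr comp_def)
        also have "distr ?X borel (\<lambda>X. ctranspose H ** X) = ?Z"
          by (rule distr_gaussian_coisometric_matrix[OF \<sigma> H])
        finally show "emeasure (distr ?X borel (\<lambda>X. ?\<phi> (X ** ctranspose X) (Y ** ctranspose Y))) T
          = emeasure (distr ?Z borel (\<lambda>Z. ?\<psi> (Z ** ctranspose Z) (ctranspose Y ** Y))) T" by simp
      qed
    qed
    also have "\<dots> = emeasure (distr N borel (\<lambda>\<omega>. ?\<psi> (U \<omega>) (W \<omega>))) T"
      by (rule emeasure_distr_indep_pair[symmetric, OF N UW U[unfolded wish] W'
            prob_space_gaussian[OF \<sigma>] prob_space_gaussian[OF \<sigma>] _ _ meas(2) T]) simp_all
    finally show "emeasure (distr M borel (\<lambda>\<omega>. ?\<phi> (A \<omega>) (B \<omega>))) T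
        = emeasure (distr N borel (\<lambda>\<omega>. ?\<psi> (U \<omega>) (W \<omega>))) T" .
  qed simp
  then show ?thesis
    unfolding same_distribution_def by simp
qed

theorem theorem4:
  fixes M :: "'s measure" and N :: "'t measure"
  assumes "prob_space M" and "prob_space N"
    and "CARD('n::finite) < CARD('m::finite)" and "CARD('m) < CARD('p::finite)"
  shows "(\<forall>(A :: 's \<Rightarrow> real^'p^'p) (B :: 's \<Rightarrow> real^'p^'p)
             (U :: 't \<Rightarrow> real^'m^'m) (W :: 't \<Rightarrow> real^'m^'m).
           prob_space.indep_var M borel A borel B \<and>
           distr M borel A = wishart TYPE('n) (mat 1) \<and>
           distr M borel B = wishart TYPE('m) (mat 1) \<and>
           prob_space.indep_var N borel U borel W \<and>
           distr N borel U = wishart TYPE('n) (mat 1) \<and>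
           distr N borel W = wishart TYPE('p) (mat 1) \<longrightarrow>
           same_distribution
             M (\<lambda>\<omega>. largest_eigenvalue (A \<omega> ** moore_penrose_inv (B \<omega>)))
             N (\<lambda>\<omega>. largest_eigenvalue (U \<omega> ** matrix_inv (W \<omega>)))) \<and>
         (\<forall>(A :: 's \<Rightarrow> complex^'p^'p) (B :: 's \<Rightarrow> complex^'p^'p)
             (U :: 't \<Rightarrow> complex^'m^'m) (W :: 't \<Rightarrow> complex^'m^'m).
           prob_space.indep_var M borel A borel B \<and>
           distr M borel A = wishart TYPE('n) (mat 1) \<and>
           distr M borel B = wishart TYPE('m) (mat 1) \<and>
           prob_space.indep_var N borel U borel W \<and>
           distr N borel U = wishart TYPE('n) (mat 1) \<and>
           distr N borel W = wishart TYPE('p) (mat 1) \<longrightarrow>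
           same_distribution
             M (\<lambda>\<omega>. largest_eigenvalue (A \<omega> ** moore_penrose_inv (B \<omega>)))
             N (\<lambda>\<omega>. largest_eigenvalue (U \<omega> ** matrix_inv (W \<omega>)))) \<and>
         (\<forall>(A :: 's \<Rightarrow> quat^'p^'p) (B :: 's \<Rightarrow> quat^'p^'p)
             (U :: 't \<Rightarrow> quat^'m^'m) (W :: 't \<Rightarrow> quat^'m^'m).
           prob_space.indep_var M borel A borel B \<and>
           distr M borel A = wishart TYPE('n) (mat 1) \<and>
           distr M borel B = wishart TYPE('m) (mat 1) \<and>
           prob_space.indep_var N borel U borel W \<and>
           distr N borel U = wishart TYPE('n) (mat 1) \<and>
           distr N borel W = wishart TYPE('p) (mat 1) \<longrightarrow>
           same_distribution
             M (\<lambda>\<omega>. largest_eigenvalue (A \<omega> ** moore_penrose_inv (B \<omega>)))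
             N (\<lambda>\<omega>. largest_eigenvalue (U \<omega> ** matrix_inv (W \<omega>))))"
  by (intro conjI allI impI; elim conjE; rule largest_eigenvalue_duality[OF assms])

end
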